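(* If $f\equiv0$ (i.e. the system has no drift), then the problem of minimizing $\int_0^1L(x(t),u(t))\,dt$ subject to $\dot x=f(x)+G(x)u$, $x(0)=x^0$, $x(1)=x^1$ has no $L_1^k[0,1]$-$\mathcal F_{k,1}^0$ Lavrentiev gap.
   Context: The vector fields $f,g_1,\dots,g_k$ on $\mathbb R^n$ are locally Lipschitz, $G=(g_1,\dots,g_k)$, $x^0,x^1\in\mathbb R^n$. $L:\mathbb R^{n+k}\to\mathbb R$ is continuous, and convex in $u$. On $\mathbb R^n\times[0,+\infty[\times\mathbb R^k$: $\lambda(y,v,w)=L(y,\frac wv)v$ for $v>0$, $\lambda(y,0,w)=\lim_{\eta\to0^+}L(y,\frac w\eta)\eta\in\,]-\infty,+\infty]$. Generalized controls: let $\mathcal T$ be the set of increasing locally absolutely continuous bijections of $[0,+\infty[$ with locally absolutely continuous inverse; locally absolutely continuous functions $g_1,g_2$ on $[0,+\infty[$ are equivalent if $\inf_{\alpha\in\mathcal T}\|g_1-g_2\circ\alpha\|_{L_\infty[0,+\infty[}=0$. $\mathcal F_{k,1}^0$ is the set of equivalence classes $[(V,W)]$ of locally absolutely continuous $(V,W):[0,+\infty[\to\mathbb R^{1+k}$ with $V(0)=0$, $W(0)=0$, $\dot V\ge0$ a.e., infinite total length, and $V(\infty)>1$. Put $(v,w)=(\dot V,\dot W)$, $V^{\#}(1)=\sup\{s\ge0:V(s)\le1\}$, let $y_{(v,w)}$ be the maximal solution of $\dot y=f(y)v+G(y)w$, $y(0)=x^0$, and, when it is defined on $[0,V^{\#}(1)]$,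 put $I([(V,W)])=\int_0^{V^{\#}(1)}\lambda(y_{(v,w)},v,w)\,d\tau$ (independent of the representative). For $u\in L_1^k[0,1]$, $U(t)=\int_0^tu\,ds$ and $x_u$ is the trajectory of $\dot x=f(x)+G(x)u$, $x(0)=x^0$; then $I([(t,U)])=\int_0^1L(x_u,u)\,dt$. Lavrentiev gap: the problem (the functional $I$) exhibits an $L_1^k[0,1]$-$\mathcal F_{k,1}^0$ Lavrentiev gap if $$\lim_{\varepsilon\to0^+}\ \inf_{u\in L_1^k[0,1],\ |x_u(1)-x^1|\le\varepsilon}I([(t,U)])\ >\ \inf_{[(V,W)]\in\mathcal F_{k,1}^0,\ y_{(v,w)}(V^{\#}(1))=x^1}I([(V,W)]),$$ where only controls whose trajectories are defined up to the final time are considered, and $\inf\emptyset=+\infty$. *)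

theory Defs
  imports "HOL-Analysis.Analysis" "HOL-Probability.Essential_Supremum"
begin

definition abs_cont_on :: "real \<Rightarrow> real \<Rightarrow> (real \<Rightarrow> 'a::real_normed_vector) \<Rightarrow> bool" where
  "abs_cont_on a b h \<longleftrightarrow>
     (\<forall>\<epsilon>>0. \<exists>\<delta>>0. \<forall>D :: (real \<times> real) set.
        finite D \<and> (\<forall>(s, t)\<in>D. a \<le> s \<and> s \<le> t \<and> t \<le> b) \<and>
        disjoint_family_on (\<lambda>(s, t). {s<..<t}) D \<and> (\<Sum>(s, t)\<in>D. t - s) < \<delta>
        \<longrightarrow> (\<Sum>(s, t)\<in>D. norm (h t - h s)) < \<epsilon>)"

text \<open>Functions on \<open>[0,\<infinity>[\<close> are total functions on the reals whose values at
  negative arguments are irrelevant.\<close>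

definition loc_abs_cont :: "(real \<Rightarrow> 'a::real_normed_vector) \<Rightarrow> bool" where
  "loc_abs_cont h \<longleftrightarrow> (\<forall>T\<ge>0. abs_cont_on 0 T h)"

definition time_changes :: "(real \<Rightarrow> real) set" where
  "time_changes = {\<alpha>. strict_mono_on {0..} \<alpha> \<and> bij_betw \<alpha> {0..} {0..} \<and>
     loc_abs_cont \<alpha> \<and> loc_abs_cont (inv_into {0..} \<alpha>)}"

definition param_equiv :: "((real \<Rightarrow> 'a::real_normed_vector) \<times> (real \<Rightarrow> 'a)) set" where
  "param_equiv = {(h1, h2). loc_abs_cont h1 \<and> loc_abs_cont h2 \<and>
     (INF \<alpha>\<in>time_changes.
        esssup (lebesgue_on {0..}) (\<lambda>t. ereal (norm (h1 t - h2 (\<alpha> t))))) = 0}"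

text \<open>A parametrized generalized control is a map \<open>p = (V, W)\<close>; its derivative components
  are \<open>v\<close> and \<open>w\<close>. The derivatives exist almost everywhere, and \<open>vector_derivative\<close>
  is arbitrary on the exceptional null set.\<close>

definition vdot :: "(real \<Rightarrow> real \<times> (real^'k)) \<Rightarrow> real \<Rightarrow> real" where
  "vdot p t = vector_derivative (\<lambda>s. fst (p s)) (at t)"

definition wdot :: "(real \<Rightarrow> real \<times> (real^'k)) \<Rightarrow> real \<Rightarrow> real^'k" where
  "wdot p t = vector_derivative (\<lambda>s. snd (p s)) (at t)"

definition gen_control_params :: "(real \<Rightarrow> real \<times> (real^'k)) set" where
  "gen_control_params = {p. loc_abs_cont p \<and> p 0 = (0, 0) \<and>
     (AE t in lebesgue_on {0..}. vdot p t \<ge> 0) \<and>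
     (\<integral>\<^sup>+t\<in>{0..}. ennreal (norm (vdot p t, wdot p t)) \<partial>lebesgue) = \<infinity> \<and>
     Lim at_top (\<lambda>s. ereal (fst (p s))) > 1}"

definition gen_controls :: "(real \<Rightarrow> real \<times> (real^'k)) set set" where
  "gen_controls = gen_control_params // param_equiv"

definition final_param :: "(real \<Rightarrow> real \<times> (real^'k)) \<Rightarrow> real" where
  "final_param p = Sup {s. 0 \<le> s \<and> fst (p s) \<le> 1}"

text \<open>The parametrized generalized control \<open>t \<mapsto> (t, U(t))\<close> of an ordinary control \<open>u\<close>
  on \<open>[0,1]\<close>, which is extended by \<open>0\<close> beyond \<open>1\<close>.\<close>

definition graph_control :: "(real \<Rightarrow> real^'k) \<Rightarrow> real \<Rightarrow> real \<times> (real^'k)" where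
  "graph_control u t = (t, (LINT s:{0..min t 1}|lebesgue. u s))"

definition solves_on ::
  "(real^'n \<Rightarrow> real^'n) \<Rightarrow> ('k::finite \<Rightarrow> real^'n \<Rightarrow> real^'n) \<Rightarrow> real^'n \<Rightarrow>
   (real \<Rightarrow> real) \<Rightarrow> (real \<Rightarrow> real^'k) \<Rightarrow> real \<Rightarrow> (real \<Rightarrow> real^'n) \<Rightarrow> bool" where
  "solves_on f g x0 v w T y \<longleftrightarrow> abs_cont_on 0 T y \<and> y 0 = x0 \<and>
     (AE t in lebesgue_on {0..T}. (y has_vector_derivative
        (v t *\<^sub>R f (y t) + (\<Sum>i\<in>UNIV. (w t $ i) *\<^sub>R g i (y t)))) (at t))"

text \<open>Solutions are unique for locally Lipschitz vector fields, so the maximal solution is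
  defined on \<open>[0,T]\<close> iff there is a solution on \<open>[0,T]\<close>, and its value at \<open>t\<close> is the common
  value of all solutions on \<open>[0,t]\<close>.\<close>

definition traj_defined ::
  "(real^'n \<Rightarrow> real^'n) \<Rightarrow> ('k::finite \<Rightarrow> real^'n \<Rightarrow> real^'n) \<Rightarrow> real^'n \<Rightarrow>
   (real \<Rightarrow> real) \<Rightarrow> (real \<Rightarrow> real^'k) \<Rightarrow> real \<Rightarrow> bool" where
  "traj_defined f g x0 v w T \<longleftrightarrow> (\<exists>y. solves_on f g x0 v w T y)"

definition traj ::
  "(real^'n \<Rightarrow> real^'n) \<Rightarrow> ('k::finite \<Rightarrow> real^'n \<Rightarrow> real^'n) \<Rightarrow> real^'n \<Rightarrow>
   (real \<Rightarrow> real) \<Rightarrow> (real \<Rightarrow> real^'k) \<Rightarrow> real \<Rightarrow> real^'n" where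
  "traj f g x0 v w t = (THE z. \<exists>y. solves_on f g x0 v w t y \<and> y t = z)"

text \<open>Only \<open>v \<ge> 0\<close> is relevant.\<close>

definition lam :: "(real^'n \<Rightarrow> real^'k \<Rightarrow> real) \<Rightarrow> real^'n \<Rightarrow> real \<Rightarrow> real^'k \<Rightarrow> ereal" where
  "lam L y v w = (if v > 0 then ereal (L y (w /\<^sub>R v) * v)
     else Lim (at_right 0) (\<lambda>\<eta>. ereal (L y (w /\<^sub>R \<eta>) * \<eta>)))"

text \<open>Lebesgue integral of an extended-real function. In the intended use the negative
  part has finite integral, so the difference is never \<open>\<infinity> - \<infinity>\<close>.\<close>

definition ereal_integral :: "real set \<Rightarrow> (real \<Rightarrow> ereal) \<Rightarrow> ereal" where
  "ereal_integral A h = enn2ereal (\<integral>\<^sup>+t\<in>A. e2ennreal (h t) \<partial>lebesgue)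
     - enn2ereal (\<integral>\<^sup>+t\<in>A. e2ennreal (- h t) \<partial>lebesgue)"

definition gen_cost ::
  "(real^'n \<Rightarrow> real^'n) \<Rightarrow> ('k::finite \<Rightarrow> real^'n \<Rightarrow> real^'n) \<Rightarrow>
   (real^'n \<Rightarrow> real^'k \<Rightarrow> real) \<Rightarrow> real^'n \<Rightarrow> (real \<Rightarrow> real \<times> (real^'k)) \<Rightarrow> ereal" where
  "gen_cost f g L x0 p = ereal_integral {0..final_param p}
     (\<lambda>\<tau>. lam L (traj f g x0 (vdot p) (wdot p) \<tau>) (vdot p \<tau>) (wdot p \<tau>))"

definition ordinary_controls ::
  "(real^'n \<Rightarrow> real^'n) \<Rightarrow> ('k::finite \<Rightarrow> real^'n \<Rightarrow> real^'n) \<Rightarrow> real^'n \<Rightarrow> real^'n \<Rightarrow>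
   real \<Rightarrow> (real \<Rightarrow> real^'k) set" where
  "ordinary_controls f g x0 x1 \<epsilon> = {u. set_integrable lebesgue {0..1} u \<and>
     traj_defined f g x0 (\<lambda>_. 1) u 1 \<and> norm (traj f g x0 (\<lambda>_. 1) u 1 - x1) \<le> \<epsilon>}"

text \<open>All representatives of all classes in \<open>gen_controls\<close> that steer \<open>x0\<close> to \<open>x1\<close>. The
  endpoint and the cost do not depend on the representative.\<close>

definition steering_gen_controls ::
  "(real^'n \<Rightarrow> real^'n) \<Rightarrow> ('k::finite \<Rightarrow> real^'n \<Rightarrow> real^'n) \<Rightarrow> real^'n \<Rightarrow> real^'n \<Rightarrow>
   (real \<Rightarrow> real \<times> (real^'k)) set" where
  "steering_gen_controls f g x0 x1 = {p \<in> \<Union>gen_controls.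
     traj_defined f g x0 (vdot p) (wdot p) (final_param p) \<and>
     traj f g x0 (vdot p) (wdot p) (final_param p) = x1}"

definition lavrentiev_gap ::
  "(real^'n \<Rightarrow> real^'n) \<Rightarrow> ('k::finite \<Rightarrow> real^'n \<Rightarrow> real^'n) \<Rightarrow>
   (real^'n \<Rightarrow> real^'k \<Rightarrow> real) \<Rightarrow> real^'n \<Rightarrow> real^'n \<Rightarrow> bool" where
  "lavrentiev_gap f g L x0 x1 \<longleftrightarrow>
     Lim (at_right 0)
       (\<lambda>\<epsilon>. INF u\<in>ordinary_controls f g x0 x1 \<epsilon>. gen_cost f g L x0 (graph_control u))
     > (INF p\<in>steering_gen_controls f g x0 x1. gen_cost f g L x0 p)"

end

theory Submission
  imports Defs
begin

text \<open>
  Without drift the trajectory only depends on the curve traced by \<open>W\<close>, so \<open>V\<close> may be replaced by any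
  other increasing parametrization without moving the endpoint. Given a generalized control steering
  to \<open>x1\<close>, put \<open>\<psi> = (1 + |w|) / m\<close>, where \<open>m\<close> makes the integral of \<open>\<psi>\<close> over \<open>[0, T]\<close>, with \<open>T\<close> the
  final parameter, equal to \<open>1\<close>, and replace \<open>v\<close> by \<open>\<omega> = (1 - \<eta>) v + \<eta> \<psi>\<close>. As \<open>\<omega>\<close> is bounded
  below by \<open>\<eta> / m\<close> and \<open>w / \<omega>\<close> is bounded, this yields an ordinary control with the same endpoint.
  Joint convexity of \<open>\<lambda>\<close> in \<open>(v, w)\<close> bounds its cost by \<open>1 - \<eta>\<close> times the generalized cost plus a
  term of order \<open>\<eta>\<close>: \<open>w / \<psi>\<close> is bounded by \<open>m\<close>, so \<open>L (y, w / \<psi>)\<close> is bounded along the trajectory.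
\<close>

section \<open>Absolutely continuous functions\<close>

text \<open>The obstacle is that \<open>v\<close> may vanish on a set of positive measure, so that
  \<open>V\<close> has no absolutely continuous inverse and the trajectory cannot be run in the time
  \<open>V\<close>. In \<psi> the summand 1 gives the new clock a Lipschitz inverse, and the summand
  |w| bounds the new control. Using \<psi> alone would change the cost beyond control, while the
  mixture changes it only by a term of order \<eta>. Both \<open>v\<close> and \<psi> have integral
  1 over [0, T], so every mixture still runs exactly from time 0 to time 1. Convexity of \<lambda>
  enters only between two points with the same \<open>w\<close>. Since \<lambda> may be infinite,
  the convexity inequality is solved for \<lambda>: a real integrable function bounds it from below.
  Before that, the \<epsilon>-\<delta> definition of absolute continuity has to yield derivatives
  almost everywhere whose integrals are the increments; the densities come from the Radon-Nikodym
  theorem for monotone functions, and the variation reduces the general case to that one.\<close>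

definition nonoverlapping :: "real \<Rightarrow> real \<Rightarrow> 'i set \<Rightarrow> ('i \<Rightarrow> real) \<Rightarrow> ('i \<Rightarrow> real) \<Rightarrow> bool" where
  "nonoverlapping a b I s t \<longleftrightarrow> finite I \<and> (\<forall>i\<in>I. a \<le> s i \<and> s i \<le> t i \<and> t i \<le> b) \<and>
     disjoint_family_on (\<lambda>i. {s i<..<t i}) I"

lemma abs_cont_on_iff:
  "abs_cont_on a b h \<longleftrightarrow> (\<forall>\<epsilon>>0. \<exists>\<delta>>0. \<forall>D. nonoverlapping a b D fst snd \<longrightarrow>
     (\<Sum>i\<in>D. snd i - fst i) < \<delta> \<longrightarrow> (\<Sum>i\<in>D. norm (h (snd i) - h (fst i))) < \<epsilon>)"
proof -
  have "(\<lambda>(x, y). {x<..<y}) = (\<lambda>i :: real \<times> real. {fst i<..<snd i})" by auto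
  then show ?thesis
    unfolding abs_cont_on_def nonoverlapping_def by (simp add: split_beta imp_conjL)
qed

text \<open>An indexed family may repeat an interval, a set of pairs cannot, and repetitions arise
  when intervals are truncated or mapped. Only degenerate intervals can repeat, since disjoint
  nonempty open intervals differ, and these contribute nothing to either sum. Discarding them makes
  the indexing injective.\<close>

lemma abs_cont_onD:
  assumes "abs_cont_on a b h" "\<epsilon> > 0"
  shows "\<exists>\<delta>>0. \<forall>(I::'i set) s t. nonoverlapping a b I s t \<longrightarrow>
     (\<Sum>i\<in>I. t i - s i) < \<delta> \<longrightarrow> (\<Sum>i\<in>I. norm (h (t i) - h (s i))) < \<epsilon>"
proof -
  obtain \<delta> where \<delta>: "\<delta> > 0" and
    *: "\<forall>D. nonoverlapping a b D fst snd \<longrightarrow>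
     (\<Sum>i\<in>D. snd i - fst i) < \<delta> \<longrightarrow> (\<Sum>i\<in>D. norm (h (snd i) - h (fst i))) < \<epsilon>"
    using assms unfolding abs_cont_on_iff by blast
  have "(\<Sum>i\<in>I. norm (h (t i) - h (s i))) < \<epsilon>"
    if I: "nonoverlapping a b I s t" and sum: "(\<Sum>i\<in>I. t i - s i) < \<delta>" for I :: "'i set" and s t
  proof -
    note I = I[unfolded nonoverlapping_def disjoint_family_on_def]
    define J where "J = {i \<in> I. s i < t i}"
    define D where "D = (\<lambda>i. (s i, t i)) ` J"
    have J: "finite J" "J \<subseteq> I" using I by (auto simp: J_def)
    have inj: "inj_on (\<lambda>i. (s i, t i)) J"
    proof (rule inj_onI)
      fix i j assume ij: "i \<in> J" "j \<in> J" "(s i, t i) = (s j, t j)"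
      show "i = j"
      proof (rule ccontr)
        assume "i \<noteq> j"
        then have "{s i<..<t i} \<inter> {s j<..<t j} = {}"
          using I ij J by blast
        then show False using ij by (auto simp: J_def)
      qed
    qed
    have eq: "(\<Sum>i\<in>I. norm (h (t i) - h (s i))) = (\<Sum>i\<in>J. norm (h (t i) - h (s i)))"
      using I by (intro sum.mono_neutral_right) (force simp: J_def)+
    have eq2: "(\<Sum>i\<in>I. t i - s i) = (\<Sum>i\<in>J. t i - s i)"
      using I by (intro sum.mono_neutral_right) (force simp: J_def)+
    have "disjoint_family_on (\<lambda>i. {fst i<..<snd i}) D"
      unfolding disjoint_family_on_def
    proof (intro ballI impI)
      fix m n assume "m \<in> D" "n \<in> D" "m \<noteq> n"
      then obtain i j where "i \<in> J" "j \<in> J" "m = (s i, t i)" "n = (s j, t j)" "i \<noteq> j"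
        unfolding D_def by blast
      moreover from this have "{s i<..<t i} \<inter> {s j<..<t j} = {}"
        using I J by blast
      ultimately show "{fst m<..<snd m} \<inter> {fst n<..<snd n} = {}"
        by simp
    qed
    then have "nonoverlapping a b D fst snd"
      using I J by (auto simp: nonoverlapping_def D_def)
    moreover have "(\<Sum>i\<in>D. snd i - fst i) < \<delta>"
      using sum unfolding D_def by (simp add: sum.reindex[OF inj] eq2)
    ultimately have "(\<Sum>i\<in>D. norm (h (snd i) - h (fst i))) < \<epsilon>"
      using * by blast
    then show "(\<Sum>i\<in>I. norm (h (t i) - h (s i))) < \<epsilon>"
      unfolding D_def by (simp add: sum.reindex[OF inj] eq)
  qed
  with \<delta> show ?thesis by blast
qed

lemma abs_cont_on_dominated:
  assumes "abs_cont_on a b \<phi>"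
    and le: "\<And>s t. a \<le> s \<Longrightarrow> s \<le> t \<Longrightarrow> t \<le> b \<Longrightarrow> norm (h t - h s) \<le> C * norm (\<phi> t - \<phi> s)"
  shows "abs_cont_on a b h"
  unfolding abs_cont_on_iff
proof (intro allI impI)
  fix \<epsilon> :: real assume "\<epsilon> > 0"
  \<comment> \<open>\<open>C\<close> may be zero or negative; the maximum with 1 makes
    \<open>\<epsilon> / c\<close> a positive tolerance.\<close>
  define c where "c = max C 1"
  have c: "c > 0" "C \<le> c" by (auto simp: c_def)
  from \<open>\<epsilon> > 0\<close> c have "\<epsilon> / c > 0" by simp
  with assms(1) obtain \<delta> where \<delta>: "\<delta> > 0" and
    *: "\<forall>D. nonoverlapping a b D fst snd \<longrightarrow>
     (\<Sum>i\<in>D. snd i - fst i) < \<delta> \<longrightarrow> (\<Sum>i\<in>D. norm (\<phi> (snd i) - \<phi> (fst i))) < \<epsilon> / c"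
    unfolding abs_cont_on_iff by blast
  have "(\<Sum>i\<in>D. norm (h (snd i) - h (fst i))) < \<epsilon>"
    if D: "nonoverlapping a b D fst snd" "(\<Sum>i\<in>D. snd i - fst i) < \<delta>" for D
  proof -
    have "(\<Sum>i\<in>D. norm (h (snd i) - h (fst i))) \<le> (\<Sum>i\<in>D. c * norm (\<phi> (snd i) - \<phi> (fst i)))"
    proof (rule sum_mono)
      fix i assume "i \<in> D"
      with D(1) have "norm (h (snd i) - h (fst i)) \<le> C * norm (\<phi> (snd i) - \<phi> (fst i))"
        by (intro le) (auto simp: nonoverlapping_def)
      also have "\<dots> \<le> c * norm (\<phi> (snd i) - \<phi> (fst i))" using c by (intro mult_right_mono) auto
      finally show "norm (h (snd i) - h (fst i)) \<le> c * norm (\<phi> (snd i) - \<phi> (fst i))" .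
    qed
    also have "\<dots> = c * (\<Sum>i\<in>D. norm (\<phi> (snd i) - \<phi> (fst i)))" by (simp add: sum_distrib_left)
    also have "\<dots> < c * (\<epsilon> / c)" using D c * by (intro mult_strict_left_mono) blast+
    finally show ?thesis using c by simp
  qed
  with \<delta> show "\<exists>\<delta>>0. \<forall>D. nonoverlapping a b D fst snd \<longrightarrow>
     (\<Sum>i\<in>D. snd i - fst i) < \<delta> \<longrightarrow> (\<Sum>i\<in>D. norm (h (snd i) - h (fst i))) < \<epsilon>" by blast
qed

lemma nonoverlapping_mono:
  "nonoverlapping c d I s t \<Longrightarrow> a \<le> c \<Longrightarrow> d \<le> b \<Longrightarrow> nonoverlapping a b I s t"
  unfolding nonoverlapping_def by (meson order_trans)

lemma abs_cont_on_subset: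
  assumes "abs_cont_on a b h" "a \<le> c" "d \<le> b"
  shows "abs_cont_on c d h"
  using assms(1) nonoverlapping_mono[OF _ assms(2,3)] unfolding abs_cont_on_iff by meson

lemma abs_cont_on_interval_bound:
  assumes "abs_cont_on a b h" "\<epsilon> > 0"
  shows "\<exists>\<delta>>0. \<forall>s t. a \<le> s \<longrightarrow> s \<le> t \<longrightarrow> t \<le> b \<longrightarrow> t - s < \<delta> \<longrightarrow> norm (h t - h s) < \<epsilon>"
proof -
  obtain \<delta> where "\<delta> > 0" and
    *: "\<forall>(I::unit set) s t. nonoverlapping a b I s t \<longrightarrow>
     (\<Sum>i\<in>I. t i - s i) < \<delta> \<longrightarrow> (\<Sum>i\<in>I. norm (h (t i) - h (s i))) < \<epsilon>"
    using abs_cont_onD[OF assms] by blast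
  then show ?thesis
    using *[rule_format, of "{()}" "\<lambda>_. s" "\<lambda>_. t" for s t]
    by (intro exI[of _ \<delta>]) (auto simp: nonoverlapping_def disjoint_family_on_def)
qed

lemma abs_cont_on_imp_continuous_on:
  assumes "abs_cont_on a b h"
  shows "continuous_on {a..b} h"
  unfolding continuous_on_iff
proof (intro ballI allI impI)
  fix x e :: real assume x: "x \<in> {a..b}" and "0 < e"
  then obtain \<delta> where \<delta>: "\<delta> > 0"
    "\<forall>s t. a \<le> s \<longrightarrow> s \<le> t \<longrightarrow> t \<le> b \<longrightarrow> t - s < \<delta> \<longrightarrow> norm (h t - h s) < e"
    using abs_cont_on_interval_bound[OF assms] by blast
  have "dist (h x') (h x) < e" if "x' \<in> {a..b}" "dist x' x < \<delta>" for x'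
    using that x \<delta>(2)[rule_format, of x x'] \<delta>(2)[rule_format, of x' x]
    by (cases "x \<le> x'") (auto simp: dist_norm norm_minus_commute)
  with \<delta>(1) show "\<exists>d>0. \<forall>x'\<in>{a..b}. dist x' x < d \<longrightarrow> dist (h x') (h x) < e" by blast
qed

section \<open>Total variation\<close>

definition variation_sums :: "(real \<Rightarrow> 'a::real_normed_vector) \<Rightarrow> real \<Rightarrow> real \<Rightarrow> real set" where
  "variation_sums h a b =
     {\<Sum>i<n. norm (h (t i) - h (s i)) | (n::nat) s t. nonoverlapping a b {..<n} s t}"

definition variation :: "(real \<Rightarrow> 'a::real_normed_vector) \<Rightarrow> real \<Rightarrow> real \<Rightarrow> real" where
  "variation h a b = Sup (variation_sums h a b)"

lemma nonoverlapping_length: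
  assumes "nonoverlapping a b I s t" "a \<le> b"
  shows "(\<Sum>i\<in>I. t i - s i) \<le> b - a"
proof -
  note no = assms(1)[unfolded nonoverlapping_def]
  have "(\<Sum>i\<in>I. t i - s i) = (\<Sum>i\<in>I. measure lborel {s i<..<t i})"
    using no by (intro sum.cong) auto
  also have "\<dots> = measure lborel (\<Union>i\<in>I. {s i<..<t i})"
    using no by (intro measure_finite_Union[symmetric]) (auto simp: emeasure_lborel_box_eq)
  also have "\<dots> \<le> measure lborel {a..b}"
  proof (rule measure_mono_fmeasurable)
    show "(\<Union>i\<in>I. {s i<..<t i}) \<subseteq> {a..b}" using no by force
  qed (use no in \<open>auto simp: fmeasurable_def emeasure_lborel_Icc_eq intro!: sets.finite_UN\<close>)
  finally show ?thesis using \<open>a \<le> b\<close> by simp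
qed

lemma variation_sumsI:
  "nonoverlapping a b {..<n::nat} s t \<Longrightarrow> (\<Sum>i<n. norm (h (t i) - h (s i))) \<in> variation_sums h a b"
  unfolding variation_sums_def by blast

lemma variation_sums_zero: "0 \<in> variation_sums h a b"
  unfolding variation_sums_def
  by (intro CollectI exI[of _ 0]) (simp add: nonoverlapping_def disjoint_family_on_def)

lemma variation_sums_split:
  assumes "r \<in> variation_sums h a b" "a \<le> c" "c \<le> b"
  shows "\<exists>p\<in>variation_sums h a c. \<exists>q\<in>variation_sums h c b. r \<le> p + q"
proof -
  obtain n :: nat and s t where r: "r = (\<Sum>i<n. norm (h (t i) - h (s i)))"
    and no: "nonoverlapping a b {..<n} s t"
    using assms(1) unfolding variation_sums_def by blast
  let ?p = "\<Sum>i<n. norm (h (min (t i) c) - h (min (s i) c))"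
  let ?q = "\<Sum>i<n. norm (h (max (t i) c) - h (max (s i) c))"
  note no' = no[unfolded nonoverlapping_def disjoint_family_on_def]
  have "nonoverlapping a c {..<n} (\<lambda>i. min (s i) c) (\<lambda>i. min (t i) c)"
    unfolding nonoverlapping_def disjoint_family_on_def
  proof (intro conjI ballI impI)
    fix i j assume "i \<in> {..<n}" "j \<in> {..<n}" "i \<noteq> j"
    then have "{s i<..<t i} \<inter> {s j<..<t j} = {}" using no' by blast
    moreover have "{min (s i) c<..<min (t i) c} \<subseteq> {s i<..<t i}" for i by auto
    ultimately show "{min (s i) c<..<min (t i) c} \<inter> {min (s j) c<..<min (t j) c} = {}" by blast
  qed (use no' assms in \<open>auto simp: min_le_iff_disj\<close>)
  then have p: "?p \<in> variation_sums h a c"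
    by (rule variation_sumsI)
  have "nonoverlapping c b {..<n} (\<lambda>i. max (s i) c) (\<lambda>i. max (t i) c)"
    unfolding nonoverlapping_def disjoint_family_on_def
  proof (intro conjI ballI impI)
    fix i j assume "i \<in> {..<n}" "j \<in> {..<n}" "i \<noteq> j"
    then have "{s i<..<t i} \<inter> {s j<..<t j} = {}" using no' by blast
    moreover have "{max (s i) c<..<max (t i) c} \<subseteq> {s i<..<t i}" for i by auto
    ultimately show "{max (s i) c<..<max (t i) c} \<inter> {max (s j) c<..<max (t j) c} = {}" by blast
  next
    fix i assume "i \<in> {..<n}"
    then have "s i \<le> t i" "t i \<le> b" using no' by auto
    then show "c \<le> max (s i) c" "max (s i) c \<le> max (t i) c" "max (t i) c \<le> b"
      using assms by auto
  qed auto
  then have q: "?q \<in> variation_sums h c b"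
    by (rule variation_sumsI)
  have "norm (h (t i) - h (s i)) \<le>
      norm (h (min (t i) c) - h (min (s i) c)) + norm (h (max (t i) c) - h (max (s i) c))"
    if "i < n" for i
  proof -
    have "s i \<le> t i" using no' that by auto
    then show ?thesis
      using norm_triangle_ineq[of "h (t i) - h c" "h c - h (s i)"]
      by (cases "t i \<le> c"; cases "s i \<le> c") (auto simp: min_def max_def)
  qed
  then have "r \<le> ?p + ?q" unfolding r sum.distrib[symmetric] by (intro sum_mono) auto
  with p q show ?thesis by blast
qed

lemma variation_sums_extend:
  assumes "r \<in> variation_sums h a b" "a \<le> b" "b \<le> c"
  shows "r + norm (h c - h b) \<in> variation_sums h a c"
proof -
  obtain n :: nat and s t where r: "r = (\<Sum>i<n. norm (h (t i) - h (s i)))"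
    and no: "nonoverlapping a b {..<n} s t"
    using assms(1) unfolding variation_sums_def by blast
  note no' = no[unfolded nonoverlapping_def disjoint_family_on_def]
  let ?s = "s(n := b)" and ?t = "t(n := c)"
  have le: "t i \<le> b" if "i < n" for i using no' that by auto
  have "nonoverlapping a c {..<Suc n} ?s ?t"
    unfolding nonoverlapping_def disjoint_family_on_def
  proof (intro conjI ballI impI)
    fix i j assume "i \<in> {..<Suc n}" "j \<in> {..<Suc n}" "i \<noteq> j"
    then show "{?s i<..<?t i} \<inter> {?s j<..<?t j} = {}"
      using no' le[of i] le[of j] by (cases "i < n"; cases "j < n") (auto simp: less_Suc_eq min_le_iff_disj le_max_iff_disj)
  qed (use no' assms in \<open>auto simp: less_Suc_eq\<close>, force)
  moreover have "r + norm (h c - h b) = (\<Sum>i<Suc n. norm (h (?t i) - h (?s i)))"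
    unfolding r by simp
  ultimately show ?thesis using variation_sumsI by metis
qed

text \<open>On an interval shorter than the \<delta> that belongs to the tolerance 1, all sums are
  at most 1. Finitely many such intervals cover \<open>{a..b}\<close>, and splitting adds their
  bounds.\<close>

lemma abs_cont_on_bdd_above_variation_sums:
  assumes "abs_cont_on a b h"
  shows "bdd_above (variation_sums h a b)"
proof -
  obtain \<delta> where \<delta>: "\<delta> > 0" and
    *: "\<forall>(I::nat set) s t. nonoverlapping a b I s t \<longrightarrow>
     (\<Sum>i\<in>I. t i - s i) < \<delta> \<longrightarrow> (\<Sum>i\<in>I. norm (h (t i) - h (s i))) < 1"
    using abs_cont_onD[OF assms, of 1] by auto
  have loc: "r \<le> 1" if r: "r \<in> variation_sums h c d" "a \<le> c" "c \<le> d" "d \<le> b" "d - c < \<delta>" for c d r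
  proof -
    obtain n :: nat and s t where r: "r = (\<Sum>i<n. norm (h (t i) - h (s i)))"
      and no: "nonoverlapping c d {..<n} s t"
      using r(1) unfolding variation_sums_def by blast
    have "nonoverlapping a b {..<n} s t" by (rule nonoverlapping_mono[OF no]) (use that in auto)
    moreover have "(\<Sum>i\<in>{..<n}. t i - s i) < \<delta>" using nonoverlapping_length[OF no] that by linarith
    ultimately show ?thesis unfolding r using * by (intro less_imp_le) blast
  qed
  \<comment> \<open>Blocks of length \<delta>/2 stay strictly shorter than \<delta>. The bound is
    \<open>Suc n\<close> and not \<open>n\<close> because at \<open>n = 0\<close> the one-point
    interval is already estimated through \<open>loc\<close>, which gives 1.\<close>
  have *: "\<forall>r\<in>variation_sums h a (min b (a + real n * (\<delta>/2))). r \<le> real (Suc n)" if "a \<le> b" for n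
  proof (induction n)
    case 0
    then show ?case using loc[of _ a a] that \<delta> by (auto simp: min_def)
  next
    case (Suc n)
    show ?case
    proof
      fix r assume r: "r \<in> variation_sums h a (min b (a + real (Suc n) * (\<delta>/2)))"
      let ?c = "min b (a + real n * (\<delta>/2))" and ?d = "min b (a + real (Suc n) * (\<delta>/2))"
      have c: "a \<le> ?c" "?c \<le> ?d" "?d \<le> b" "?d - ?c < \<delta>"
        using that \<delta> by (auto simp: min_def field_simps)
      obtain p q where pq: "p \<in> variation_sums h a ?c" "q \<in> variation_sums h ?c ?d" "r \<le> p + q"
        using variation_sums_split[OF r c(1,2)] by blast
      have "q \<le> 1" using loc[OF pq(2) c] .
      moreover have "p \<le> real (Suc n)" using Suc pq by blast
      ultimately show "r \<le> real (Suc (Suc n))" using pq(3) by simp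
    qed
  qed
  show ?thesis
  proof (cases "a \<le> b")
    case True
    obtain n :: nat where "(b - a) / (\<delta>/2) < real n" using reals_Archimedean2 by blast
    then have "min b (a + real n * (\<delta>/2)) = b" using \<delta> by (auto simp: field_simps)
    with *[OF True, of n] show ?thesis by (auto intro!: bdd_aboveI)
  next
    case False
    have "r \<le> 1" if r: "r \<in> variation_sums h a b" for r
    proof -
      obtain n :: nat and s t where r: "r = (\<Sum>i<n. norm (h (t i) - h (s i)))"
        and no: "nonoverlapping a b {..<n} s t"
        using r unfolding variation_sums_def by blast
      have "n = 0" using no False unfolding nonoverlapping_def by (cases n) force+
      then show ?thesis using r by simp
    qed
    then show ?thesis by (auto intro!: bdd_aboveI)
  qed
qed

text \<open>With a norm in place of the second variation, this yields at once that the variation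
  increases and that it dominates the increments of \<open>h\<close>, the two facts behind the
  decomposition into monotone functions.\<close>

lemma variation_superadd:
  assumes "abs_cont_on a c h" "a \<le> b" "b \<le> c"
  shows "variation h a b + norm (h c - h b) \<le> variation h a c"
proof -
  have "variation h a b \<le> variation h a c - norm (h c - h b)"
    unfolding variation_def[of h a b]
  proof (rule cSup_least)
    show "variation_sums h a b \<noteq> {}" using variation_sums_zero by blast
    fix r assume "r \<in> variation_sums h a b"
    from variation_sums_extend[OF this assms(2,3)]
    have "r + norm (h c - h b) \<le> variation h a c"
      unfolding variation_def by (intro cSup_upper abs_cont_on_bdd_above_variation_sums assms)
    then show "r \<le> variation h a c - norm (h c - h b)" by simp
  qed
  then show ?thesis by simp
qed

lemma variation_subadd:
  assumes "abs_cont_on a c h" "a \<le> b" "b \<le> c"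
  shows "variation h a c \<le> variation h a b + variation h b c"
  unfolding variation_def[of h a c]
proof (rule cSup_least)
  show "variation_sums h a c \<noteq> {}" using variation_sums_zero by blast
  fix r assume "r \<in> variation_sums h a c"
  then obtain p q where pq: "p \<in> variation_sums h a b" "q \<in> variation_sums h b c" "r \<le> p + q"
    using variation_sums_split assms by blast
  have "p \<le> variation h a b"
    unfolding variation_def
    using assms by (intro cSup_upper pq abs_cont_on_bdd_above_variation_sums abs_cont_on_subset[OF assms(1)]) auto
  moreover have "q \<le> variation h b c"
    unfolding variation_def
    using assms by (intro cSup_upper pq abs_cont_on_bdd_above_variation_sums abs_cont_on_subset[OF assms(1)]) auto
  ultimately show "r \<le> variation h a b + variation h b c" using pq(3) by linarith
qed

text \<open>In each interval of \<open>D\<close> a family is chosen that nearly attains its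
  variation. All these families together are again non-overlapping, with total length at most that
  of \<open>D\<close>, so the \<delta> of \<open>h\<close> for \<epsilon>/2 controls their joint
  sum. The joint family is indexed by an interval of \<open>D\<close> and a number.\<close>

lemma abs_cont_on_variation:
  assumes h: "abs_cont_on a b h"
  shows "abs_cont_on a b (variation h a)"
  unfolding abs_cont_on_iff
proof (intro allI impI)
  fix \<epsilon> :: real assume "\<epsilon> > 0"
  then obtain \<delta> where \<delta>: "\<delta> > 0" and
    *: "\<forall>(I::((real \<times> real) \<times> nat) set) s t. nonoverlapping a b I s t \<longrightarrow>
     (\<Sum>i\<in>I. t i - s i) < \<delta> \<longrightarrow> (\<Sum>i\<in>I. norm (h (t i) - h (s i))) < \<epsilon> / 2"
    using abs_cont_onD[OF h, of "\<epsilon>/2"] half_gt_zero by blast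
  have "(\<Sum>i\<in>D. norm (variation h a (snd i) - variation h a (fst i))) < \<epsilon>"
    if D: "nonoverlapping a b D fst snd" "(\<Sum>i\<in>D. snd i - fst i) < \<delta>" for D
  proof -
    note D' = D(1)[unfolded nonoverlapping_def disjoint_family_on_def]
    \<comment> \<open>The errors of the near-optimal families add up to at most \<epsilon>/4; the
      added 1 avoids division by zero when \<open>D\<close> is empty.\<close>
    define e where "e = \<epsilon> / (4 * (real (card D) + 1))"
    have e: "e > 0" using \<open>\<epsilon> > 0\<close> by (simp add: e_def)
    let ?P = "\<lambda>i q. nonoverlapping (fst i) (snd i) {..<fst q :: nat} (fst (snd q)) (snd (snd q)) \<and>
        variation h (fst i) (snd i) - e < (\<Sum>j<fst q. norm (h (snd (snd q) j) - h (fst (snd q) j)))"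
    have "\<exists>q. ?P i q" for i
    proof -
      have "variation h (fst i) (snd i) - e < Sup (variation_sums h (fst i) (snd i))"
        using e by (simp add: variation_def)
      then obtain r where r: "r \<in> variation_sums h (fst i) (snd i)" "variation h (fst i) (snd i) - e < r"
        using less_cSupE variation_sums_zero by (metis empty_iff)
      then obtain n :: nat and s t where "r = (\<Sum>j<n. norm (h (t j) - h (s j)))"
        "nonoverlapping (fst i) (snd i) {..<n} s t"
        unfolding variation_sums_def by blast
      with r(2) show ?thesis by (intro exI[of _ "(n, s, t)"]) simp
    qed
    then have "\<forall>i. \<exists>q. ?P i q" by (rule allI)
    from choice[OF this] obtain q where q: "\<forall>i. ?P i (q i)" ..
    define n s t where "n = (\<lambda>i. fst (q i))" and "s = (\<lambda>i. fst (snd (q i)))"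
      and "t = (\<lambda>i. snd (snd (q i)))"
    have nst: "nonoverlapping (fst i) (snd i) {..<n i} (s i) (t i)"
       "variation h (fst i) (snd i) - e < (\<Sum>j<n i. norm (h (t i j) - h (s i j)))" for i
      using q[rule_format, of i] unfolding n_def s_def t_def by blast+
    define I where "I = (SIGMA i:D. {..<n i})"
    have nst': "fst i \<le> s i j" "s i j \<le> t i j" "t i j \<le> snd i" if "i \<in> D" "j < n i" for i j
      using nst(1)[of i] that(2) unfolding nonoverlapping_def by auto
    have finD: "finite D" using D' by blast
    have no: "nonoverlapping a b I (\<lambda>(i, j). s i j) (\<lambda>(i, j). t i j)"
      unfolding nonoverlapping_def disjoint_family_on_def
    proof (intro conjI ballI impI)
      show "finite I" using finD by (auto simp: I_def)
      fix x assume "x \<in> I"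
      then obtain i j where x: "x = (i, j)" "i \<in> D" "j < n i" by (auto simp: I_def)
      have "a \<le> fst i" "snd i \<le> b" using D' x by auto
      with nst'[OF x(2,3)] x(1) show "a \<le> (case x of (i, j) \<Rightarrow> s i j)"
        "(case x of (i, j) \<Rightarrow> s i j) \<le> (case x of (i, j) \<Rightarrow> t i j)" "(case x of (i, j) \<Rightarrow> t i j) \<le> b"
        by auto
      fix y assume "y \<in> I" "x \<noteq> y"
      then obtain i' j' where y: "y = (i', j')" "i' \<in> D" "j' < n i'" by (auto simp: I_def)
      have "{s i j<..<t i j} \<inter> {s i' j'<..<t i' j'} = {}"
      proof (cases "i = i'")
        case True
        with \<open>x \<noteq> y\<close> x y have "j \<noteq> j'" by auto
        then show ?thesis using nst(1)[of i] x y True unfolding nonoverlapping_def disjoint_family_on_def by blast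
      next
        case False
        then have "{fst i<..<snd i} \<inter> {fst i'<..<snd i'} = {}" using D' x y by blast
        moreover have "{s i j<..<t i j} \<subseteq> {fst i<..<snd i}" using nst'[OF x(2,3)] by auto
        moreover have "{s i' j'<..<t i' j'} \<subseteq> {fst i'<..<snd i'}" using nst'[OF y(2,3)] by auto
        ultimately show ?thesis by blast
      qed
      then show "{(case x of (i, j) \<Rightarrow> s i j)<..<(case x of (i, j) \<Rightarrow> t i j)} \<inter>
         {(case y of (i, j) \<Rightarrow> s i j)<..<(case y of (i, j) \<Rightarrow> t i j)} = {}" using x y by simp
    qed
    have "(\<Sum>x\<in>I. (case x of (i, j) \<Rightarrow> t i j) - (case x of (i, j) \<Rightarrow> s i j)) = (\<Sum>i\<in>D. \<Sum>j<n i. t i j - s i j)"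
      unfolding I_def using finD by (subst sum.Sigma) (auto intro!: sum.cong)
    also have "\<dots> \<le> (\<Sum>i\<in>D. snd i - fst i)"
    proof (rule sum_mono)
      fix i assume i: "i \<in> D"
      show "(\<Sum>j<n i. t i j - s i j) \<le> snd i - fst i"
        using D' i by (intro nonoverlapping_length nst(1)) auto
    qed
    finally have "(\<Sum>x\<in>I. (case x of (i, j) \<Rightarrow> t i j) - (case x of (i, j) \<Rightarrow> s i j)) < \<delta>" using D by simp
    with * no have "(\<Sum>x\<in>I. norm (h (case x of (i, j) \<Rightarrow> t i j) - h (case x of (i, j) \<Rightarrow> s i j))) < \<epsilon> / 2"
      by blast
    also have "(\<Sum>x\<in>I. norm (h (case x of (i, j) \<Rightarrow> t i j) - h (case x of (i, j) \<Rightarrow> s i j)))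
       = (\<Sum>i\<in>D. \<Sum>j<n i. norm (h (t i j) - h (s i j)))"
      unfolding I_def using finD by (subst sum.Sigma) (auto intro!: sum.cong)
    finally have small: "(\<Sum>i\<in>D. \<Sum>j<n i. norm (h (t i j) - h (s i j))) < \<epsilon> / 2" .
    have "(\<Sum>i\<in>D. norm (variation h a (snd i) - variation h a (fst i)))
       \<le> (\<Sum>i\<in>D. (\<Sum>j<n i. norm (h (t i j) - h (s i j))) + e)"
    proof (rule sum_mono)
      fix i assume i: "i \<in> D"
      have le: "a \<le> fst i" "fst i \<le> snd i" "snd i \<le> b" using D' i by auto
      have h': "abs_cont_on a (snd i) h" by (rule abs_cont_on_subset[OF h]) (use le in auto)
      have "variation h a (fst i) + norm (h (snd i) - h (fst i)) \<le> variation h a (snd i)"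
        by (rule variation_superadd[OF h' le(1,2)])
      moreover have "0 \<le> norm (h (snd i) - h (fst i))" by simp
      ultimately have "variation h a (fst i) \<le> variation h a (snd i)" by linarith
      moreover have "variation h a (snd i) \<le> variation h a (fst i) + variation h (fst i) (snd i)"
        by (rule variation_subadd[OF h' le(1,2)])
      ultimately show "norm (variation h a (snd i) - variation h a (fst i)) \<le> (\<Sum>j<n i. norm (h (t i j) - h (s i j))) + e"
        using nst(2)[of i] by (simp add: real_norm_def)
    qed
    also have "\<dots> = (\<Sum>i\<in>D. \<Sum>j<n i. norm (h (t i j) - h (s i j))) + real (card D) * e"
      by (simp add: sum.distrib)
    also have "\<dots> < \<epsilon> / 2 + real (card D) * e" using small by simp
    also have "real (card D) * e \<le> \<epsilon> / 4"
      using \<open>\<epsilon> > 0\<close> unfolding e_def by (simp add: field_simps)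
    finally show ?thesis using \<open>\<epsilon> > 0\<close> by simp
  qed
  with \<delta> show "\<exists>\<delta>>0. \<forall>D. nonoverlapping a b D fst snd \<longrightarrow>
     (\<Sum>i\<in>D. snd i - fst i) < \<delta> \<longrightarrow>
     (\<Sum>i\<in>D. norm (variation h a (snd i) - variation h a (fst i))) < \<epsilon>" by blast
qed

text \<open>The Stieltjes measure of \<open>F\<close> is absolutely continuous with respect to
  Lebesgue measure, and its Radon-Nikodym derivative is the density. By inner regularity it suffices
  to treat compact null sets \<open>K\<close>. Compactness turns a thin open neighbourhood of
  \<open>K\<close> into finitely many intervals of small total length, to which the
  \<epsilon>-\<delta> condition applies.\<close>

lemma mono_abs_cont_on_density:
  fixes F :: "real \<Rightarrow> real"
  assumes ac: "abs_cont_on a b F" and "a \<le> b"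
    and mono: "\<And>s t. a \<le> s \<Longrightarrow> s \<le> t \<Longrightarrow> t \<le> b \<Longrightarrow> F s \<le> F t"
  shows "\<exists>f. f absolutely_integrable_on {a..b} \<and> (\<forall>t\<in>{a..b}. (f has_integral (F t - F a)) {a..t})"
proof -
  \<comment> \<open>Freezing the values outside \<open>{a..b}\<close> makes \<open>G\<close>
    increasing and continuous on the whole line, so that it generates a measure.\<close>
  define G where "G x = F (max a (min b x))" for x
  have "continuous_on UNIV G"
    unfolding G_def
    by (rule continuous_on_compose2[OF abs_cont_on_imp_continuous_on[OF ac]])
       (use \<open>a \<le> b\<close> in \<open>auto intro!: continuous_intros\<close>)
  then have contG: "continuous (at_right x) G" for x
    by (simp add: continuous_on_eq_continuous_at continuous_at_imp_continuous_at_within)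
  have monoG: "G x \<le> G y" if "x \<le> y" for x y
    unfolding G_def by (rule mono) (use that \<open>a \<le> b\<close> in \<open>auto simp: min_def max_def\<close>)
  \<comment> \<open>The cut-off to \<open>{a<..b}\<close> makes the total mass the single increment
    \<open>F b - F a\<close>.\<close>
  define N where "N = density (interval_measure G) (indicator {a<..b})"
  have N: "emeasure N A = emeasure (interval_measure G) ({a<..b} \<inter> A)" if "A \<in> sets borel" for A
    unfolding N_def by (rule emeasure_restricted) (use that in auto)
  have setsN: "sets N = sets borel" "space N = UNIV" by (auto simp: N_def)
  have N_Ioc: "emeasure N {s<..t} = ennreal (F t - F s)" if "a \<le> s" "s \<le> t" "t \<le> b" for s t
  proof -
    have "{a<..b} \<inter> {s<..t} = {s<..t}" using that by auto
    then have "emeasure N {s<..t} = emeasure (interval_measure G) {s<..t}" by (simp add: N)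
    also have "\<dots> = G t - G s" by (rule emeasure_interval_measure_Ioc[OF that(2) monoG contG])
    finally show ?thesis using that by (simp add: G_def)
  qed
  have finN: "emeasure N (space N) \<noteq> \<infinity>"
  proof -
    have "emeasure N UNIV = emeasure N {a<..b}" by (simp add: N)
    then show ?thesis using N_Ioc[of a b] \<open>a \<le> b\<close> by (simp add: setsN)
  qed
  have acN: "absolutely_continuous lborel N"
    unfolding absolutely_continuous_def
  proof
    fix A :: "real set" assume A: "A \<in> null_sets lborel"
    then have Ab: "A \<in> sets borel" by auto
    have "emeasure N K = 0" if K: "K \<subseteq> A" "compact K" for K
    proof -
      have Kb: "K \<in> sets borel" using K by (simp add: borel_compact)
      have K0: "emeasure lborel K = 0"
        using A K Kb by (metis emeasure_mono le_zero_eq null_setsD1 null_setsD2)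
      have le: "emeasure N K \<le> ennreal \<epsilon>" if "\<epsilon> > 0" for \<epsilon>
      proof -
        obtain \<delta> where \<delta>: "\<delta> > 0" and *: "\<forall>(I::int set) s t. nonoverlapping a b I s t \<longrightarrow>
           (\<Sum>i\<in>I. t i - s i) < \<delta> \<longrightarrow> (\<Sum>i\<in>I. norm (F (t i) - F (s i))) < \<epsilon>"
          using abs_cont_onD[OF ac \<open>\<epsilon> > 0\<close>] by blast
        obtain U where U: "open U" "K \<subseteq> U" "emeasure lborel (U - K) < ennreal \<delta>"
          using outer_regular_lborel[OF Kb \<delta>] by blast
        have "emeasure lborel U \<le> emeasure lborel (U - K) + emeasure lborel K"
          using U Kb by (metis Un_Diff_cancel2 Un_absorb2 borel_open emeasure_subadditive sets.Diff sets_lborel)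
        then have Usmall: "emeasure lborel U < ennreal \<delta>" using U(3) K0 by simp
        obtain h where h: "h > 0" "(\<Union>x\<in>K. cball x h) \<subseteq> U"
          using compact_subset_open_imp_cball_epsilon_subset[OF K(2) U(1,2)] by blast
        \<comment> \<open>the cells of a fine grid that meet \<open>K\<close> lie in \<open>U\<close>, so their total length is below \<open>\<delta>\<close>\<close>
        define I where "I = {i::int. {of_int i * h<..(of_int i + 1) * h} \<inter> K \<inter> {a<..b} \<noteq> {}}"
        define s where "s i = max a (of_int i * h)" for i :: int
        define t where "t i = min b ((of_int i + 1) * h)" for i :: int
        have "I \<subseteq> {\<lfloor>a / h\<rfloor> - 1..\<lceil>b / h\<rceil> + 1}"
        proof
          fix i assume "i \<in> I"
          then obtain x where "of_int i * h < x" "x \<le> (of_int i + 1) * h" "a < x" "x \<le> b"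
            unfolding I_def by auto
          then have "of_int i * h \<le> b" "a \<le> (of_int i + 1) * h" by auto
          then have "of_int i \<le> b / h" "a / h \<le> of_int i + 1" using h by (auto simp: field_simps)
          then show "i \<in> {\<lfloor>a / h\<rfloor> - 1..\<lceil>b / h\<rceil> + 1}" by simp linarith
        qed
        then have finI: "finite I" by (rule finite_subset) simp
        have st: "a \<le> s i" "s i < t i" "t i \<le> b" "{s i<..t i} \<subseteq> U" if i: "i \<in> I" for i
        proof -
          obtain x where x: "of_int i * h < x" "x \<le> (of_int i + 1) * h" "a < x" "x \<le> b" "x \<in> K"
            using i unfolding I_def by auto
          show "a \<le> s i" "s i < t i" "t i \<le> b" using x by (auto simp: s_def t_def)
          have "{s i<..t i} \<subseteq> cball x h"
            using x by (auto simp: s_def t_def dist_real_def algebra_simps)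
          then show "{s i<..t i} \<subseteq> U" using h x by blast
        qed
        have disj: "disjoint_family_on (\<lambda>i. {s i<..t i}) I"
          unfolding disjoint_family_on_def
        proof (intro ballI impI)
          fix i j :: int assume "i \<noteq> j"
          have *: "{s i<..t i} \<inter> {s j<..t j} = {}" if "i < j" for i j
          proof -
            have "of_int i + 1 \<le> (of_int j :: real)" using that by linarith
            then have "(of_int i + 1) * h \<le> of_int j * h" using h by simp
            then show ?thesis by (auto simp: s_def t_def)
          qed
          show "{s i<..t i} \<inter> {s j<..t j} = {}"
            using *[of i j] *[of j i] \<open>i \<noteq> j\<close> by (metis inf_commute linorder_neqE)
        qed
        have "{s i<..<t i} \<inter> {s j<..<t j} \<subseteq> {s i<..t i} \<inter> {s j<..t j}" for i j by auto
        then have "disjoint_family_on (\<lambda>i. {s i<..<t i}) I"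
          using disj unfolding disjoint_family_on_def by blast
        then have no: "nonoverlapping a b I s t"
          unfolding nonoverlapping_def using finI st(1,3) less_imp_le[OF st(2)] by blast
        have "ennreal (\<Sum>i\<in>I. t i - s i) = (\<Sum>i\<in>I. ennreal (t i - s i))"
          by (rule sum_ennreal[symmetric]) (use st(2) in \<open>auto intro: less_imp_le\<close>)
        also have "\<dots> = (\<Sum>i\<in>I. emeasure lborel {s i<..t i})"
          using st(2) by (intro sum.cong) (auto simp: less_imp_le)
        also have "\<dots> = emeasure lborel (\<Union>i\<in>I. {s i<..t i})"
          by (rule sum_emeasure) (use disj finI in auto)
        also have "\<dots> \<le> emeasure lborel U"
          by (rule emeasure_mono) (use st(4) U in auto)
        finally have "(\<Sum>i\<in>I. t i - s i) < \<delta>"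
          using Usmall by (metis ennreal_less_iff le_less_trans leI less_asym not_less \<delta> ennreal_leI)
        with * no have sm: "(\<Sum>i\<in>I. norm (F (t i) - F (s i))) < \<epsilon>" by blast
        have "{a<..b} \<inter> K \<subseteq> {a<..b} \<inter> (\<Union>i\<in>I. {s i<..t i})"
        proof
          fix x assume x: "x \<in> {a<..b} \<inter> K"
          \<comment> \<open>The cells are open on the left and closed on the right, so the one
            containing \<open>x\<close> is found by the ceiling minus 1.\<close>
          define i where "i = \<lceil>x / h\<rceil> - 1"
          have "of_int i < x / h" "x / h \<le> of_int i + 1" unfolding i_def by linarith+
          then have "of_int i * h < x" "x \<le> (of_int i + 1) * h" using h by (auto simp: field_simps)
          then have "i \<in> I" "x \<in> {s i<..t i}" using x by (auto simp: I_def s_def t_def)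
          then show "x \<in> {a<..b} \<inter> (\<Union>i\<in>I. {s i<..t i})" using x by blast
        qed
        then have "emeasure N K \<le> emeasure N (\<Union>i\<in>I. {s i<..t i})"
          by (subst (1 2) N) (use Kb finI in \<open>auto intro!: emeasure_mono\<close>)
        also have "\<dots> \<le> (\<Sum>i\<in>I. emeasure N {s i<..t i})"
          by (rule emeasure_subadditive_finite) (use finI setsN in auto)
        also have "\<dots> = (\<Sum>i\<in>I. ennreal (norm (F (t i) - F (s i))))"
        proof (rule sum.cong)
          fix i assume "i \<in> I"
          note st = st[OF this]
          then have "F (s i) \<le> F (t i)" by (intro mono) auto
          then show "emeasure N {s i<..t i} = ennreal (norm (F (t i) - F (s i)))"
            using N_Ioc[of "s i" "t i"] st by simp
        qed simp
        also have "\<dots> = ennreal (\<Sum>i\<in>I. norm (F (t i) - F (s i)))"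
          by (rule sum_ennreal) simp
        also have "\<dots> \<le> ennreal \<epsilon>" using sm by (intro ennreal_leI) simp
        finally show ?thesis .
      qed
      have "emeasure N K \<le> 0" by (rule ennreal_le_epsilon) (simp add: le)
      then show ?thesis by simp
    qed
    then have "emeasure N A = 0"
      using inner_regular[OF setsN(1) finN Ab] by (auto intro!: antisym SUP_least)
    then show "A \<in> null_sets N" using Ab setsN by auto
  qed
  obtain f where f: "f \<in> borel_measurable lborel" "density lborel f = N"
    using sigma_finite_measure.Radon_Nikodym[OF sigma_finite_lborel acN] setsN by auto
  have fN: "emeasure N A = (\<integral>\<^sup>+x\<in>A. f x \<partial>lborel)" if "A \<in> sets borel" for A
    using f that by (auto simp: emeasure_density)
  have "(\<integral>\<^sup>+x. f x \<partial>lborel) \<noteq> \<infinity>"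
    using fN[of UNIV] finN setsN by simp
  then have fin: "AE x in lborel. f x \<noteq> \<infinity>"
    by (intro nn_integral_PInf_AE f)
  \<comment> \<open>The density is finite almost everywhere, so \<open>enn2real\<close> alters it on
    a null set only.\<close>
  define r where "r x = enn2real (f x)" for x
  have hi: "(r has_integral (F t - F a)) {a..t}" if t: "t \<in> {a..b}" for t
  proof -
    have "(\<integral>\<^sup>+x. ennreal (indicator {a<..t} x * r x) \<partial>lborel) = (\<integral>\<^sup>+x\<in>{a<..t}. f x \<partial>lborel)"
    proof (rule nn_integral_cong_AE)
      show "AE x in lborel. ennreal (indicator {a<..t} x * r x) = f x * indicator {a<..t} x"
        using fin by eventually_elim (auto simp: r_def indicator_def less_top)
    qed
    also have "\<dots> = ennreal (F t - F a)"
      using fN[of "{a<..t}"] N_Ioc[of a t] t by simp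
    finally have "((\<lambda>x. indicator {a<..t} x * r x) has_integral (F t - F a)) UNIV"
      using f mono[of a t] t
      by (intro nn_integral_has_integral) (auto simp: r_def)
    also have "(\<lambda>x. indicator {a<..t} x * r x) = (\<lambda>x. if x \<in> {a<..t} then r x else 0)"
      by (auto simp: indicator_def)
    finally have "(r has_integral (F t - F a)) {a<..t}" by (subst (asm) has_integral_restrict_UNIV)
    then show ?thesis
      by (rule has_integral_spike_set_eq[THEN iffD1, rotated 2]) (auto intro: negligible_subset[OF negligible_sing[of a]])
  qed
  have "r absolutely_integrable_on {a..b}"
  proof (rule nonnegative_absolutely_integrable_1)
    show "r integrable_on {a..b}" using hi[of b] \<open>a \<le> b\<close> by auto
  qed (simp add: r_def)
  with hi show ?thesis by blast
qed

text \<open>Jordan decomposition: the variation and its sum with \<open>F\<close> are increasing,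
  and the increments of the sum are at most twice those of the variation, so both are absolutely
  continuous. The density of \<open>F\<close> is the difference of theirs.\<close>

lemma abs_cont_on_real_density:
  fixes F :: "real \<Rightarrow> real"
  assumes ac: "abs_cont_on a b F" and "a \<le> b"
  shows "\<exists>f. f absolutely_integrable_on {a..b} \<and> (\<forall>t\<in>{a..b}. (f has_integral (F t - F a)) {a..t})"
proof -
  let ?V = "variation F a"
  have V: "norm (F t - F s) \<le> ?V t - ?V s" if "a \<le> s" "s \<le> t" "t \<le> b" for s t
    using variation_superadd[OF abs_cont_on_subset[OF ac, of a t] that(1,2)] that by simp
  have acV: "abs_cont_on a b ?V" by (rule abs_cont_on_variation[OF ac])
  have "abs_cont_on a b (\<lambda>x. ?V x + F x)"
    by (rule abs_cont_on_dominated[OF acV, of _ 2]) (use V in fastforce)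
  then obtain f where f: "f absolutely_integrable_on {a..b}"
    "\<forall>t\<in>{a..b}. (f has_integral ((?V t + F t) - (?V a + F a))) {a..t}"
    using mono_abs_cont_on_density[OF _ \<open>a \<le> b\<close>, of "\<lambda>x. ?V x + F x"] V by fastforce
  obtain g where g: "g absolutely_integrable_on {a..b}"
    "\<forall>t\<in>{a..b}. (g has_integral (?V t - ?V a)) {a..t}"
    using mono_abs_cont_on_density[OF acV \<open>a \<le> b\<close>] V by fastforce
  have "(\<lambda>x. f x - g x) absolutely_integrable_on {a..b}"
    using f(1) g(1) by (rule set_integral_diff(1))
  moreover have "((\<lambda>x. f x - g x) has_integral (F t - F a)) {a..t}" if "t \<in> {a..b}" for t
    using has_integral_diff[OF f(2)[rule_format, OF that] g(2)[rule_format, OF that]] by simp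
  ultimately show ?thesis by blast
qed

lemma abs_cont_on_density:
  fixes F :: "real \<Rightarrow> 'a::euclidean_space"
  assumes ac: "abs_cont_on a b F" and "a \<le> b"
  shows "\<exists>f. f absolutely_integrable_on {a..b} \<and> (\<forall>t\<in>{a..b}. (f has_integral (F t - F a)) {a..t})"
proof -
  have "\<exists>f. f absolutely_integrable_on {a..b} \<and> (\<forall>t\<in>{a..b}. (f has_integral (F t \<bullet> i - F a \<bullet> i)) {a..t})"
    if "i \<in> Basis" for i
  proof (rule abs_cont_on_real_density[OF abs_cont_on_dominated[OF ac, of _ 1] \<open>a \<le> b\<close>])
    show "norm (F t \<bullet> i - F s \<bullet> i) \<le> 1 * norm (F t - F s)" for s t
      using Basis_le_norm[OF that, of "F t - F s"] by (simp add: inner_diff_left)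
  qed
  then obtain f where f: "\<And>i. i \<in> Basis \<Longrightarrow> f i absolutely_integrable_on {a..b}"
    "\<And>i t. i \<in> Basis \<Longrightarrow> t \<in> {a..b} \<Longrightarrow> (f i has_integral (F t \<bullet> i - F a \<bullet> i)) {a..t}"
    by metis
  let ?f = "\<lambda>x. \<Sum>i\<in>Basis. f i x *\<^sub>R i"
  have "?f absolutely_integrable_on {a..b}"
    by (rule absolutely_integrable_componentwise) (use f(1) in \<open>simp add: inner_sum_left_Basis\<close>)
  moreover have "(?f has_integral (F t - F a)) {a..t}" if "t \<in> {a..b}" for t
    by (subst has_integral_componentwise_iff) (use f(2) that in \<open>simp add: inner_sum_left_Basis inner_diff_left\<close>)
  ultimately show ?thesis by blast
qed

section \<open>Lebesgue differentiation\<close>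

text \<open>\<open>integrable_ccontinuous_explicit\<close> controls averages over intervals to the
  right of a point. Applied to the reflected function it controls those to the left, and together
  they give a two-sided derivative.\<close>

lemma lebesgue_differentiation:
  fixes f :: "real \<Rightarrow> 'a::euclidean_space"
  assumes f: "f integrable_on {a..b}"
  shows "\<exists>N. negligible N \<and> (\<forall>t\<in>{a<..<b} - N.
     ((\<lambda>t. integral {a..t} f) has_vector_derivative f t) (at t))"
proof -
  \<comment> \<open>Extension by zero makes averages available over intervals that leave
    \<open>{a..b}\<close>.\<close>
  define f0 where "f0 x = (if x \<in> {a..b} then f x else 0)" for x
  have "f0 integrable_on UNIV" unfolding f0_def using f by (simp only: integrable_restrict_UNIV)
  then have f0: "f0 integrable_on cbox c d" for c d by (rule integrable_on_subcbox) simp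
  then have f0': "(\<lambda>x. f0 (- x)) integrable_on cbox c d" for c d
    using integrable_reflect[where f=f0 and a="- d" and b="- c"] by simp
  obtain N1 where N1: "negligible N1" "\<And>x e. x \<notin> N1 \<Longrightarrow> 0 < e \<Longrightarrow> \<exists>d>0. \<forall>h. 0 < h \<and> h < d \<longrightarrow>
      norm (integral (cbox x (x + h *\<^sub>R One)) f0 /\<^sub>R h ^ DIM(real) - f0 x) < e"
    using integrable_ccontinuous_explicit[of f0] f0 by blast
  obtain N2 where N2: "negligible N2" "\<And>x e. x \<notin> N2 \<Longrightarrow> 0 < e \<Longrightarrow> \<exists>d>0. \<forall>h. 0 < h \<and> h < d \<longrightarrow>
      norm (integral (cbox x (x + h *\<^sub>R One)) (\<lambda>x. f0 (- x)) /\<^sub>R h ^ DIM(real) - f0 (- x)) < e"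
    using integrable_ccontinuous_explicit[of "\<lambda>x. f0 (- x)"] f0' by blast
  let ?N = "N1 \<union> uminus ` N2"
  have "negligible (uminus ` N2)"
    by (rule negligible_differentiable_image_negligible[OF _ N2(1)]) (auto intro!: derivative_intros)
  then have "negligible ?N" using N1(1) by simp
  moreover have "((\<lambda>t. integral {a..t} f) has_vector_derivative f t) (at t)" if t: "t \<in> {a<..<b} - ?N" for t
    unfolding has_vector_derivative_def has_derivative_at_alt
  proof (intro conjI allI impI)
    show "bounded_linear (\<lambda>x. x *\<^sub>R f t)" by (rule bounded_linear_scaleR_left)
    fix e :: real assume e: "e > 0"
    have ft: "f0 t = f t" using t by (simp add: f0_def)
    obtain d1 where d1: "d1 > 0" "\<And>h. 0 < h \<Longrightarrow> h < d1 \<Longrightarrow> norm (integral {t..t + h} f0 /\<^sub>R h - f t) < e"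
      using N1(2)[of t e] t e by (auto simp: ft)
    have "- t \<notin> N2" using t by (auto simp: image_iff)
    then obtain d2 where d2: "d2 > 0" "\<And>h. 0 < h \<Longrightarrow> h < d2 \<Longrightarrow>
        norm (integral {- t..- t + h} (\<lambda>x. f0 (- x)) /\<^sub>R h - f t) < e"
      using N2(2)[of "- t" e] e by (auto simp: ft)
    \<comment> \<open>Besides meeting the two tolerances, \<open>d\<close> keeps \<open>y\<close>
      inside \<open>{a..b}\<close>, where \<open>f0\<close> and \<open>f\<close> agree.\<close>
    define d where "d = Min {d1, d2, t - a, b - t}"
    have d: "d > 0" "d \<le> d1" "d \<le> d2" "d \<le> t - a" "d \<le> b - t" using t d1 d2 by (auto simp: d_def)
    have est: "norm (I - h *\<^sub>R f t) \<le> e * h" if "norm (I /\<^sub>R h - f t) < e" "0 < h" for I h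
    proof -
      have "I - h *\<^sub>R f t = h *\<^sub>R (I /\<^sub>R h - f t)" using that by (simp add: scaleR_diff_right)
      then have "norm (I - h *\<^sub>R f t) = h * norm (I /\<^sub>R h - f t)" using that by simp
      then show ?thesis using that by simp
    qed
    have comb: "integral {a..v} f - integral {a..u} f = integral {u..v} f0" if "a \<le> u" "u \<le> v" "v \<le> b" for u v
    proof -
      have "integral {a..u} f + integral {u..v} f = integral {a..v} f"
        by (rule Henstock_Kurzweil_Integration.integral_combine) (use that integrable_on_subinterval[OF f] in auto)
      moreover have "integral {u..v} f = integral {u..v} f0"
        by (rule integral_cong) (use that in \<open>auto simp: f0_def\<close>)
      ultimately show ?thesis by (simp add: algebra_simps)
    qed
    have "norm (integral {a..y} f - integral {a..t} f - (y - t) *\<^sub>R f t) \<le> e * norm (y - t)"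
      if y: "norm (y - t) < d" for y
    proof (cases "t \<le> y")
      case True
      show ?thesis
      proof (cases "t = y")
        case False
        with True have "0 < y - t" by simp
        from est[OF d1(2)[OF this] this] y d True
        have "norm (integral {t..y} f0 - (y - t) *\<^sub>R f t) \<le> e * (y - t)" by simp
        then show ?thesis using comb[of t y] y d t True by simp
      qed simp
    next
      case False
      then have "0 < t - y" by simp
      from est[OF d2(2)[OF this] this] y d False
      have "norm (integral {- t..- y} (\<lambda>x. f0 (- x)) - (t - y) *\<^sub>R f t) \<le> e * (t - y)" by simp
      then have "norm (integral {y..t} f0 - (t - y) *\<^sub>R f t) \<le> e * (t - y)"
        by (simp only: Henstock_Kurzweil_Integration.integral_reflect_real)
      then have "norm (- (integral {y..t} f0 - (t - y) *\<^sub>R f t)) \<le> e * (t - y)"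
        by (simp only: norm_minus_cancel)
      moreover have "integral {a..y} f - integral {a..t} f - (y - t) *\<^sub>R f t = - (integral {y..t} f0 - (t - y) *\<^sub>R f t)"
        using comb[of y t] y d t False by (simp add: algebra_simps)
      ultimately show ?thesis using False by simp
    qed
    with d(1) show "\<exists>d>0. \<forall>y. norm (y - t) < d \<longrightarrow>
         norm (integral {a..y} f - integral {a..t} f - (y - t) *\<^sub>R f t) \<le> e * norm (y - t)" by blast
  qed
  ultimately show ?thesis by blast
qed

lemma abs_cont_on_differentiable:
  fixes F :: "real \<Rightarrow> 'a::euclidean_space"
  assumes ac: "abs_cont_on a b F" and "a \<le> b"
  shows "\<exists>f N. negligible N \<and> f absolutely_integrable_on {a..b} \<and>
     (\<forall>s t. a \<le> s \<longrightarrow> s \<le> t \<longrightarrow> t \<le> b \<longrightarrow> (f has_integral (F t - F s)) {s..t}) \<and>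
     (\<forall>t\<in>{a<..<b} - N. (F has_vector_derivative f t) (at t))"
proof -
  obtain f where f: "f absolutely_integrable_on {a..b}"
      "\<forall>t\<in>{a..b}. (f has_integral (F t - F a)) {a..t}"
    using abs_cont_on_density[OF assms] by blast
  have int: "f integrable_on {a..b}" using f(1) by (rule set_lebesgue_integral_eq_integral(1))
  obtain N where N: "negligible N" "\<forall>t\<in>{a<..<b} - N.
      ((\<lambda>t. integral {a..t} f) has_vector_derivative f t) (at t)"
    using lebesgue_differentiation[OF int] by blast
  have ia: "integral {a..t} f = F t - F a" if "t \<in> {a..b}" for t
    using f(2) that by (auto intro: integral_unique)
  have "(F has_vector_derivative f t) (at t)" if t: "t \<in> {a<..<b} - N" for t
  proof -
    have "((\<lambda>t. F a + integral {a..t} f) has_vector_derivative (0 + f t)) (at t)"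
      by (rule has_vector_derivative_add) (use N(2) t in \<open>auto intro: derivative_intros\<close>)
    then have "((\<lambda>t. F a + integral {a..t} f) has_vector_derivative f t) (at t)" by simp
    then show ?thesis
      by (rule has_vector_derivative_transform_within_open[of _ _ _ "{a<..<b}"])
        (use t ia in auto)
  qed
  moreover have "(f has_integral (F t - F s)) {s..t}" if "a \<le> s" "s \<le> t" "t \<le> b" for s t
  proof -
    have "integral {a..s} f + integral {s..t} f = integral {a..t} f"
      by (rule Henstock_Kurzweil_Integration.integral_combine)
        (use that integrable_on_subinterval[OF int] in auto)
    then have "integral {s..t} f = F t - F s" using ia[of s] ia[of t] that by (simp add: algebra_simps)
    moreover have "f integrable_on {s..t}"
      by (rule integrable_on_subinterval[OF int]) (use that in auto)
    ultimately show ?thesis using integrable_integral by metis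
  qed
  ultimately show ?thesis using f(1) N(1) by blast
qed

text \<open>By uniqueness of derivatives, any almost everywhere derivative agrees with the density
  off a null set. This form suits \<open>vdot\<close> and \<open>wdot\<close>, whose values on the
  exceptional set are arbitrary.\<close>

lemma abs_cont_on_fundamental_theorem:
  fixes F :: "real \<Rightarrow> 'a::euclidean_space"
  assumes ac: "abs_cont_on a b F" and "a \<le> b" and N: "negligible N"
    and F': "\<And>t. t \<in> {a..b} - N \<Longrightarrow> (F has_vector_derivative F' t) (at t)"
  shows "F' absolutely_integrable_on {a..b}"
    and "\<And>s t. a \<le> s \<Longrightarrow> s \<le> t \<Longrightarrow> t \<le> b \<Longrightarrow> (F' has_integral (F t - F s)) {s..t}"
proof -
  obtain f M where f: "negligible M" "f absolutely_integrable_on {a..b}"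
     "\<And>s t. a \<le> s \<Longrightarrow> s \<le> t \<Longrightarrow> t \<le> b \<Longrightarrow> (f has_integral (F t - F s)) {s..t}"
     "\<And>t. t \<in> {a<..<b} - M \<Longrightarrow> (F has_vector_derivative f t) (at t)"
    using abs_cont_on_differentiable[OF assms(1,2)] by blast
  let ?N = "N \<union> M \<union> {a, b}"
  have neg: "negligible ?N" using N f(1) by simp
  have eq: "F' t = f t" if "t \<in> {a..b} - ?N" for t
    by (rule vector_derivative_unique_at[OF F' f(4)]) (use that in auto)
  show "F' absolutely_integrable_on {a..b}"
    by (rule absolutely_integrable_spike[OF f(2) neg]) (use eq in auto)
  show "(F' has_integral (F t - F s)) {s..t}" if "a \<le> s" "s \<le> t" "t \<le> b" for s t
    by (rule has_integral_spike[OF neg _ f(3)[OF that]]) (use eq that in auto)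
qed

text \<open>Lebesgue measure is complete, so the exceptional set is itself null and not merely
  contained in a null set.\<close>

lemma AE_lebesgue_on_iff_negligible:
  assumes "S \<in> sets lebesgue"
  shows "(AE t in lebesgue_on S. P t) \<longleftrightarrow> negligible {t \<in> S. \<not> P t}"
proof -
  have "(AE t in lebesgue_on S. P t) \<longleftrightarrow> (AE t in lebesgue. t \<in> S \<longrightarrow> P t)"
    by (rule AE_restrict_space_iff) (use assms in simp)
  also have "\<dots> \<longleftrightarrow> (\<exists>N. negligible N \<and> {t \<in> S. \<not> P t} \<subseteq> N)"
    unfolding eventually_ae_filter negligible_iff_null_sets by auto
  also have "\<dots> \<longleftrightarrow> negligible {t \<in> S. \<not> P t}"
    using negligible_subset by blast
  finally show ?thesis .
qed

section \<open>Uniqueness of trajectories\<close>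

text \<open>Take a block on which the integral of \<open>k\<close> is at most 1/2 and at whose left
  end \<open>z\<close> vanishes. There the maximum of the norm of \<open>z\<close> is at most half
  of itself, hence zero, and the next block starts from zero again. Uniform continuity of the
  indefinite integral gives all blocks the same length.\<close>

lemma integral_gronwall_zero:
  fixes z :: "real \<Rightarrow> 'a::real_normed_vector"
  assumes cont: "continuous_on {a..b} z" and "z a = 0" and k: "k integrable_on {a..b}"
    and step: "\<And>s t C. a \<le> s \<Longrightarrow> s \<le> t \<Longrightarrow> t \<le> b \<Longrightarrow> (\<And>r. r \<in> {s..t} \<Longrightarrow> norm (z r) \<le> C)
       \<Longrightarrow> norm (z t - z s) \<le> C * integral {s..t} k"
    and t: "t \<in> {a..b}"
  shows "z t = 0"
proof -
  have "uniformly_continuous_on {a..b} (\<lambda>t. integral {a..t} k)"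
    by (rule compact_uniformly_continuous[OF indefinite_integral_continuous_1[OF k]]) simp
  then obtain d where d: "d > 0" "\<And>x x'. x \<in> {a..b} \<Longrightarrow> x' \<in> {a..b} \<Longrightarrow> dist x' x < d \<Longrightarrow>
      dist (integral {a..x'} k) (integral {a..x} k) < 1/2"
    unfolding uniformly_continuous_on_def by (metis half_gt_zero zero_less_one)
  have small: "integral {s..t} k \<le> 1/2" if "a \<le> s" "s \<le> t" "t \<le> b" "t - s < d" for s t
  proof -
    have "integral {a..s} k + integral {s..t} k = integral {a..t} k"
      by (rule Henstock_Kurzweil_Integration.integral_combine)
        (use that integrable_on_subinterval[OF k] in auto)
    moreover have "dist (integral {a..t} k) (integral {a..s} k) < 1/2"
      by (rule d(2)) (use that in \<open>auto simp: dist_real_def\<close>)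
    ultimately show ?thesis unfolding dist_real_def by linarith
  qed
  have "\<forall>t\<in>{a..min b (a + real n * (d/2))}. z t = 0" for n
  proof (induction n)
    case 0
    then show ?case using \<open>z a = 0\<close> by auto
  next
    case (Suc n)
    let ?c = "min b (a + real n * (d/2))" and ?e = "min b (a + real (Suc n) * (d/2))"
    show ?case
    proof (cases "a \<le> b")
      case True
      have ce: "a \<le> ?c" "?c \<le> ?e" "?e \<le> b" "?e - ?c < d"
        using True d(1) by (auto simp: min_def field_simps)
      have "continuous_on {?c..?e} (\<lambda>t. norm (z t))"
        by (intro continuous_intros continuous_on_subset[OF cont]) (use ce in auto)
      then obtain r where r: "r \<in> {?c..?e}" "\<forall>t\<in>{?c..?e}. norm (z t) \<le> norm (z r)"
        using continuous_attains_sup[of "{?c..?e}" "\<lambda>t. norm (z t)"] ce by auto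
      have "z ?c = 0" using Suc ce(1) by auto
      then have "norm (z r) \<le> norm (z r) * integral {?c..r} k"
        using step[of ?c r "norm (z r)"] r ce by auto
      also have "\<dots> \<le> norm (z r) * (1/2)"
        by (rule mult_left_mono[OF small]) (use r ce in auto)
      finally have "norm (z r) \<le> 0" by simp
      then have "z t = 0" if "t \<in> {?c..?e}" for t
        using r(2) that by fastforce
      then show ?thesis using Suc by (metis atLeastAtMost_iff linear)
    qed auto
  qed
  moreover obtain n :: nat where "(t - a) / (d/2) < real n" using reals_Archimedean2 by blast
  then have "t \<in> {a..min b (a + real n * (d/2))}" using d(1) t by (auto simp: field_simps)
  ultimately show ?thesis by blast
qed

lemma solves_on_driftless_has_integral:
  assumes driftless: "\<And>x. f x = 0" and y: "solves_on f g x0 v w T y" and st: "0 \<le> s" "s \<le> t" "t \<le> T"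
  shows "((\<lambda>r. \<Sum>i\<in>UNIV. (w r $ i) *\<^sub>R g i (y r)) has_integral (y t - y s)) {s..t}"
proof -
  let ?N = "{t \<in> {0..T}. \<not> (y has_vector_derivative (\<Sum>i\<in>UNIV. (w t $ i) *\<^sub>R g i (y t))) (at t)}"
  have "negligible ?N"
    using y driftless unfolding solves_on_def
    by (subst AE_lebesgue_on_iff_negligible[symmetric]) auto
  then show ?thesis
    using y st by (intro abs_cont_on_fundamental_theorem(2)[of 0 T y ?N]) (auto simp: solves_on_def)
qed

lemma solves_on_mono:
  assumes "solves_on f g x0 v w T y" "t \<le> T"
  shows "solves_on f g x0 v w t y"
proof -
  let ?P = "\<lambda>r. (y has_vector_derivative (v r *\<^sub>R f (y r) + (\<Sum>i\<in>UNIV. (w r $ i) *\<^sub>R g i (y r)))) (at r)"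
  have "negligible {r \<in> {0..T}. \<not> ?P r}"
    using assms(1) unfolding solves_on_def by (subst AE_lebesgue_on_iff_negligible[symmetric]) auto
  then have "negligible {r \<in> {0..t}. \<not> ?P r}"
    by (rule negligible_subset) (use assms(2) in auto)
  then have "AE r in lebesgue_on {0..t}. ?P r"
    by (subst AE_lebesgue_on_iff_negligible) auto
  then show ?thesis
    using assms abs_cont_on_subset[of 0 T y 0 t] unfolding solves_on_def by auto
qed

context
  fixes f :: "real^'n \<Rightarrow> real^'n" and g :: "'k::finite \<Rightarrow> real^'n \<Rightarrow> real^'n"
  assumes lip: "\<And>i. local_lipschitz (UNIV :: real set) UNIV (\<lambda>_. g i)"
    and driftless: "\<And>x. f x = 0"
begin

text \<open>Both trajectories stay in the compact set \<open>K\<close>, on which the fields have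
  Lipschitz constants \<open>l i\<close>. The difference then satisfies a Gronwall estimate whose
  kernel is a multiple of the norm of \<open>w\<close>, integrable though possibly
  unbounded.\<close>

lemma solves_on_unique:
  assumes w: "w absolutely_integrable_on {0..T}"
    and y1: "solves_on f g x0 v w T y1" and y2: "solves_on f g x0 v w T y2"
    and t: "t \<in> {0..T}"
  shows "y1 t = y2 t"
proof -
  have c1: "continuous_on {0..T} y1" and c2: "continuous_on {0..T} y2"
    using y1 y2 abs_cont_on_imp_continuous_on unfolding solves_on_def by blast+
  define K where "K = y1 ` {0..T} \<union> y2 ` {0..T}"
  have "compact K" unfolding K_def
    by (intro compact_Un compact_continuous_image c1 c2) auto
  have "\<exists>l. l-lipschitz_on K (g i)" for i
  proof -
    have ll: "local_lipschitz {0::real} K (\<lambda>_. g i)"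
      by (rule local_lipschitz_subset[OF lip]) auto
    show ?thesis
      by (rule local_lipschitz_compact_implies_lipschitz[OF ll \<open>compact K\<close>]) auto
  qed
  then obtain l where l: "\<And>i. (l i)-lipschitz_on K (g i)" by metis
  define k where "k r = (\<Sum>i\<in>UNIV. l i) * norm (w r)" for r
  have k: "k integrable_on {0..T}"
    unfolding k_def using w by (intro integrable_on_mult_right) (simp add: absolutely_integrable_on_def)
  have "y1 t - y2 t = 0"
  proof (rule integral_gronwall_zero[OF _ _ k _ t, of "\<lambda>t. y1 t - y2 t"])
    show "continuous_on {0..T} (\<lambda>t. y1 t - y2 t)" by (intro continuous_intros c1 c2)
    show "y1 0 - y2 0 = 0" using y1 y2 unfolding solves_on_def by simp
    fix s t C assume st: "0 \<le> s" "s \<le> t" "t \<le> T" and C: "\<And>r. r \<in> {s..t} \<Longrightarrow> norm (y1 r - y2 r) \<le> C"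
    let ?D = "\<lambda>r. (\<Sum>i\<in>UNIV. (w r $ i) *\<^sub>R g i (y1 r)) - (\<Sum>i\<in>UNIV. (w r $ i) *\<^sub>R g i (y2 r))"
    have D: "(?D has_integral ((y1 t - y1 s) - (y2 t - y2 s))) {s..t}"
      by (intro has_integral_diff solves_on_driftless_has_integral[OF driftless y1 st]
          solves_on_driftless_has_integral[OF driftless y2 st])
    have "norm (integral {s..t} ?D) \<le> integral {s..t} (\<lambda>r. C * k r)"
    proof (rule integral_norm_bound_integral)
      show "?D integrable_on {s..t}" using D by auto
      show "(\<lambda>r. C * k r) integrable_on {s..t}"
        by (intro integrable_on_mult_right integrable_on_subinterval[OF k]) (use st in auto)
      fix r assume r: "r \<in> {s..t}"
      have K: "y1 r \<in> K" "y2 r \<in> K" using r st by (auto simp: K_def)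
      have "norm (?D r) = norm (\<Sum>i\<in>UNIV. (w r $ i) *\<^sub>R (g i (y1 r) - g i (y2 r)))"
        by (simp add: sum_subtractf scaleR_diff_right)
      also have "\<dots> \<le> (\<Sum>i\<in>UNIV. norm ((w r $ i) *\<^sub>R (g i (y1 r) - g i (y2 r))))"
        by (rule norm_sum)
      also have "\<dots> \<le> (\<Sum>i\<in>UNIV. norm (w r) * (l i * C))"
      proof (rule sum_mono)
        fix i
        have l0: "0 \<le> l i" using l lipschitz_on_nonneg by blast
        have "norm (g i (y1 r) - g i (y2 r)) \<le> l i * norm (y1 r - y2 r)"
          using lipschitz_onD[OF l K] by (simp add: dist_norm)
        also have "\<dots> \<le> l i * C" using C[OF r] l0 by (intro mult_left_mono)
        finally have "norm (g i (y1 r) - g i (y2 r)) \<le> l i * C" .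
        moreover have "\<bar>w r $ i\<bar> \<le> norm (w r)" by (rule component_le_norm_cart)
        ultimately show "norm ((w r $ i) *\<^sub>R (g i (y1 r) - g i (y2 r))) \<le> norm (w r) * (l i * C)"
          by (auto intro!: mult_mono)
      qed
      also have "\<dots> = C * k r"
        by (simp add: k_def sum_distrib_left sum_distrib_right mult_ac)
      finally show "norm (?D r) \<le> C * k r" .
    qed
    then show "norm (y1 t - y2 t - (y1 s - y2 s)) \<le> C * integral {s..t} k"
      using integral_unique[OF D] by (simp add: algebra_simps)
  qed
  then show ?thesis by simp
qed

text \<open>Uniqueness turns the definite description in \<open>traj\<close> into the value of
  whichever solution is at hand.\<close>

lemma traj_eq:
  assumes w: "w absolutely_integrable_on {0..T}"
    and y: "solves_on f g x0 v w T y" and t: "t \<in> {0..T}"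
  shows "traj f g x0 v w t = y t"
  unfolding traj_def
proof (rule the_equality)
  have yt: "solves_on f g x0 v w t y" by (rule solves_on_mono[OF y]) (use t in auto)
  then show "\<exists>ya. solves_on f g x0 v w t ya \<and> ya t = y t" by blast
  fix z assume "\<exists>ya. solves_on f g x0 v w t ya \<and> ya t = z"
  then obtain y' where y': "solves_on f g x0 v w t y'" "y' t = z" by blast
  have "w absolutely_integrable_on {0..t}"
    by (rule absolutely_integrable_on_subinterval[OF w]) (use t in auto)
  from solves_on_unique[OF this y'(1) yt, of t] show "z = y t" using y'(2) t by simp
qed

end

section \<open>Generalized controls\<close>

lemma loc_abs_cont_imp_continuous_on:
  assumes "loc_abs_cont h"
  shows "continuous_on {0..} h"
  unfolding continuous_on_eq_continuous_within
proof
  fix t :: real assume t: "t \<in> {0..}"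
  have "continuous_on {0..t + 1} h"
    by (rule abs_cont_on_imp_continuous_on) (use assms t in \<open>simp add: loc_abs_cont_def\<close>)
  then have "continuous (at t within {0..t + 1}) h"
    using t by (simp add: continuous_on_eq_continuous_within)
  moreover have "at t within {0..} = at t within {0..t + 1}"
    by (rule at_within_nhd[of _ "{..<t + 1}"]) (use t in auto)
  ultimately show "continuous (at t within {0..}) h"
    by (simp add: continuous_within)
qed

section \<open>Components of a parametrized control and their derivatives\<close>

lemma abs_cont_on_fst:
  assumes "abs_cont_on a b p"
  shows "abs_cont_on a b (\<lambda>t. fst (p t))"
proof (rule abs_cont_on_dominated[OF assms, where C = 1])
  show "norm (fst (p t) - fst (p s)) \<le> 1 * norm (p t - p s)" for s t
    using norm_fst_le[of "fst (p t - p s)" "snd (p t - p s)", unfolded prod.collapse] by simp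
qed

lemma abs_cont_on_snd:
  assumes "abs_cont_on a b p"
  shows "abs_cont_on a b (\<lambda>t. snd (p t))"
proof (rule abs_cont_on_dominated[OF assms, where C = 1])
  show "norm (snd (p t) - snd (p s)) \<le> 1 * norm (p t - p s)" for s t
    using norm_snd_le[of "snd (p t - p s)" "fst (p t - p s)", unfolded prod.collapse] by simp
qed

lemma vdot_has_derivative:
  assumes "loc_abs_cont p" "0 \<le> T"
  shows "\<exists>N. negligible N \<and> (\<forall>t\<in>{0..T} - N. ((\<lambda>s. fst (p s)) has_vector_derivative vdot p t) (at t))"
proof -
  have "abs_cont_on 0 T (\<lambda>t. fst (p t))" using assms by (intro abs_cont_on_fst) (simp add: loc_abs_cont_def)
  from abs_cont_on_differentiable[OF this \<open>0 \<le> T\<close>] obtain f N where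
    N: "negligible N" "\<forall>t\<in>{0<..<T} - N. ((\<lambda>t. fst (p t)) has_vector_derivative f t) (at t)" by blast
  \<comment> \<open>The endpoints join the null set: a two-sided derivative at 0 would involve
    values at negative arguments.\<close>
  have "((\<lambda>s. fst (p s)) has_vector_derivative vdot p t) (at t)" if "t \<in> {0..T} - (N \<union> {0, T})" for t
  proof -
    have "t \<in> {0<..<T} - N" using that by (auto simp: less_le)
    then have "((\<lambda>s. fst (p s)) has_vector_derivative f t) (at t)" using N(2) by blast
    then show ?thesis by (simp add: vdot_def vector_derivative_at)
  qed
  moreover have "negligible (N \<union> {0, T})" using N(1) by simp
  ultimately show ?thesis by blast
qed

lemma wdot_has_derivative:
  assumes "loc_abs_cont p" "0 \<le> T"
  shows "\<exists>N. negligible N \<and> (\<forall>t\<in>{0..T} - N. ((\<lambda>s. snd (p s)) has_vector_derivative wdot p t) (at t))"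
proof -
  have "abs_cont_on 0 T (\<lambda>t. snd (p t))" using assms by (intro abs_cont_on_snd) (simp add: loc_abs_cont_def)
  from abs_cont_on_differentiable[OF this \<open>0 \<le> T\<close>] obtain f N where
    N: "negligible N" "\<forall>t\<in>{0<..<T} - N. ((\<lambda>t. snd (p t)) has_vector_derivative f t) (at t)" by blast
  have "((\<lambda>s. snd (p s)) has_vector_derivative wdot p t) (at t)" if "t \<in> {0..T} - (N \<union> {0, T})" for t
  proof -
    have "t \<in> {0<..<T} - N" using that by (auto simp: less_le)
    then have "((\<lambda>s. snd (p s)) has_vector_derivative f t) (at t)" using N(2) by blast
    then show ?thesis by (simp add: wdot_def vector_derivative_at)
  qed
  moreover have "negligible (N \<union> {0, T})" using N(1) by simp
  ultimately show ?thesis by blast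
qed

lemma gen_control_params_mono:
  assumes p: "p \<in> gen_control_params" and st: "0 \<le> s" "s \<le> t"
  shows "fst (p s) \<le> fst (p t)"
proof -
  have ac: "loc_abs_cont p" and nonneg: "AE t in lebesgue_on {0..}. vdot p t \<ge> 0"
    using p by (auto simp: gen_control_params_def)
  have t: "0 \<le> t" using st by simp
  obtain N where N: "negligible N"
    "\<forall>t\<in>{0..t} - N. ((\<lambda>s. fst (p s)) has_vector_derivative vdot p t) (at t)"
    using vdot_has_derivative[OF ac t] by blast
  have "abs_cont_on 0 t (\<lambda>t. fst (p t))"
    using ac t by (intro abs_cont_on_fst) (simp add: loc_abs_cont_def)
  from abs_cont_on_fundamental_theorem(2)[OF this t N(1) _ st] N(2)
  have hi: "(vdot p has_integral (fst (p t) - fst (p s))) {s..t}" by blast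
  have neg: "negligible {t \<in> {0..}. \<not> vdot p t \<ge> 0}"
    using nonneg by (subst (asm) AE_lebesgue_on_iff_negligible) auto
  have "((\<lambda>r. if vdot p r \<ge> 0 then vdot p r else 0) has_integral (fst (p t) - fst (p s))) {s..t}"
    by (rule has_integral_spike[OF neg _ hi]) (use st in auto)
  then have "0 \<le> fst (p t) - fst (p s)" by (rule has_integral_nonneg) auto
  then show ?thesis by simp
qed

lemma gen_control_params_reach:
  assumes p: "p \<in> gen_control_params"
  shows "\<exists>t\<ge>0. fst (p t) > 1"
proof -
  \<comment> \<open>\<open>Lim\<close> is a description that says something only once convergence is
    known; an increasing function converges to its supremum.\<close>
  let ?l = "SUP t\<in>{0..}. ereal (fst (p t))"
  have "((\<lambda>s. ereal (fst (p s))) \<longlongrightarrow> ?l) at_top"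
  proof (rule order_tendstoI)
    fix a assume "a < ?l"
    then obtain t where t: "t \<ge> 0" "a < ereal (fst (p t))" by (auto simp: less_SUP_iff)
    have "a < ereal (fst (p s))" if "t \<le> s" for s
      using t gen_control_params_mono[OF p t(1) that] by (meson ereal_less_eq(3) order_less_le_trans)
    then show "\<forall>\<^sub>F s in at_top. a < ereal (fst (p s))"
      unfolding eventually_at_top_linorder by blast
  next
    fix a assume a: "?l < a"
    have "ereal (fst (p s)) < a" if "0 \<le> s" for s
      using a that by (meson SUP_upper atLeast_iff order_le_less_trans)
    then show "\<forall>\<^sub>F s in at_top. ereal (fst (p s)) < a"
      unfolding eventually_at_top_linorder by blast
  qed
  then have "Lim at_top (\<lambda>s. ereal (fst (p s))) = ?l" by (intro tendsto_Lim) auto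
  then have "?l > 1" using p by (simp add: gen_control_params_def)
  then show ?thesis by (auto simp: less_SUP_iff one_ereal_def)
qed

text \<open>The essential supremum bounds the distance only almost everywhere. The distance is
  continuous, so a violation at \<open>t\<close> would persist on an interval, which is not
  negligible.\<close>

lemma param_equiv_close:
  assumes qp: "(q, p) \<in> param_equiv" and e: "e > 0"
  shows "\<exists>\<alpha>\<in>time_changes. \<forall>t\<ge>0. norm (q t - p (\<alpha> t)) \<le> e"
proof -
  have q: "loc_abs_cont q" and p: "loc_abs_cont p"
    and inf: "(INF \<alpha>\<in>time_changes.
        esssup (lebesgue_on {0..}) (\<lambda>t. ereal (norm (q t - p (\<alpha> t))))) = 0"
    using qp by (auto simp: param_equiv_def)
  have "(INF \<alpha>\<in>time_changes.
        esssup (lebesgue_on {0..}) (\<lambda>t. ereal (norm (q t - p (\<alpha> t))))) < ereal e"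
    using e by (simp add: inf)
  then obtain \<alpha> where \<alpha>: "\<alpha> \<in> time_changes"
      "esssup (lebesgue_on {0..}) (\<lambda>t. ereal (norm (q t - p (\<alpha> t)))) < ereal e"
    by (auto simp: INF_less_iff)
  have "AE t in lebesgue_on {0..}. ereal (norm (q t - p (\<alpha> t))) \<le>
      esssup (lebesgue_on {0..}) (\<lambda>t. ereal (norm (q t - p (\<alpha> t))))" by (rule esssup_AE)
  then have "AE t in lebesgue_on {0..}. norm (q t - p (\<alpha> t)) \<le> e"
  proof eventually_elim
    case (elim t)
    then have "ereal (norm (q t - p (\<alpha> t))) < ereal e" using \<alpha>(2) by (rule order_le_less_trans)
    then show ?case by simp
  qed
  then have neg: "negligible {t \<in> {0..}. \<not> norm (q t - p (\<alpha> t)) \<le> e}"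
    by (subst (asm) AE_lebesgue_on_iff_negligible) auto
  have \<alpha>': "loc_abs_cont \<alpha>" "bij_betw \<alpha> {0..} {0..}" using \<alpha> by (auto simp: time_changes_def)
  have "continuous_on {0..} (\<lambda>t. p (\<alpha> t))"
    by (rule continuous_on_compose2[OF loc_abs_cont_imp_continuous_on[OF p] loc_abs_cont_imp_continuous_on[OF \<alpha>'(1)]])
      (use \<alpha>'(2) in \<open>auto simp: bij_betw_def\<close>)
  then have cont: "continuous_on {0..} (\<lambda>t. norm (q t - p (\<alpha> t)))"
    by (intro continuous_intros loc_abs_cont_imp_continuous_on[OF q])
  have "norm (q t - p (\<alpha> t)) \<le> e" if t: "t \<ge> 0" for t
  proof (rule ccontr)
    assume "\<not> ?thesis"
    then have "norm (q t - p (\<alpha> t)) - e > 0" by simp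
    with cont[unfolded continuous_on_iff, rule_format, of t] t
    obtain d where d: "d > 0" "\<And>s. s \<ge> 0 \<Longrightarrow> dist s t < d \<Longrightarrow>
        dist (norm (q s - p (\<alpha> s))) (norm (q t - p (\<alpha> t))) < norm (q t - p (\<alpha> t)) - e"
      by (metis atLeast_iff)
    \<comment> \<open>The interval lies to the right of \<open>t\<close> in order to stay in the
      half-line when \<open>t = 0\<close>.\<close>
    have "{t..t + d/2} \<subseteq> {t \<in> {0..}. \<not> norm (q t - p (\<alpha> t)) \<le> e}"
    proof
      fix s assume s: "s \<in> {t..t + d/2}"
      then have "dist (norm (q s - p (\<alpha> s))) (norm (q t - p (\<alpha> t))) < norm (q t - p (\<alpha> t)) - e"
        using t d(1) by (intro d(2)) (auto simp: dist_real_def)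
      then have "norm (q s - p (\<alpha> s)) > e" unfolding dist_real_def by linarith
      then show "s \<in> {t \<in> {0..}. \<not> norm (q t - p (\<alpha> t)) \<le> e}" using s t by simp
    qed
    then have "negligible {t..t + d/2}" by (rule negligible_subset[OF neg])
    then have "negligible (cbox t (t + d/2))" by simp
    then have "box t (t + d/2) = {}" by (simp only: negligible_interval)
    then show False using d(1) by simp
  qed
  with \<alpha>(1) show ?thesis by blast
qed

text \<open>A member of a class in \<open>gen_controls\<close> need not satisfy the conditions of \<open>gen_control_params\<close>
  by definition; those that matter survive the approximation by time changes.\<close>

lemma gen_control_representative:
  assumes p: "p \<in> \<Union>gen_controls"
  shows "loc_abs_cont p" "p 0 = (0, 0)"
    and "\<And>s t. 0 \<le> s \<Longrightarrow> s \<le> t \<Longrightarrow> fst (p s) \<le> fst (p t)"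
    and "\<exists>t\<ge>0. fst (p t) > 1"
proof -
  obtain q where q: "q \<in> gen_control_params" "(q, p) \<in> param_equiv"
    using p unfolding gen_controls_def quotient_def by blast
  show "loc_abs_cont p" using q(2) by (simp add: param_equiv_def)
  have fst_close: "\<bar>fst (q t) - fst (p s)\<bar> \<le> e" if "norm (q t - p s) \<le> e" for t s e
    using norm_fst_le[of "fst (q t - p s)" "snd (q t - p s)", unfolded prod.collapse] that by simp
  \<comment> \<open>An increasing bijection of the half-line fixes 0, so the two initial values are
    arbitrarily close.\<close>
  have "norm (q 0 - p 0) \<le> 0 + e" if e: "e > 0" for e
  proof -
    obtain \<alpha> where \<alpha>: "\<alpha> \<in> time_changes" "\<forall>t\<ge>0. norm (q t - p (\<alpha> t)) \<le> e"
      using param_equiv_close[OF q(2) e] by blast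
    have *: "strict_mono_on {0..} \<alpha>" "\<alpha> ` {0..} = {0..}"
      using \<alpha>(1) by (auto simp: time_changes_def bij_betw_def)
    then obtain s where s: "s \<ge> 0" "\<alpha> s = 0" by (metis atLeast_iff imageE order_refl)
    have "\<alpha> 0 \<ge> 0" using *(2) by (metis atLeast_iff imageI order_refl)
    have "s = 0"
    proof (rule ccontr)
      assume "s \<noteq> 0"
      then have "\<alpha> 0 < \<alpha> s" using s by (intro strict_mono_onD[OF *(1)]) auto
      then show False using s \<open>\<alpha> 0 \<ge> 0\<close> by simp
    qed
    then show ?thesis using \<alpha>(2)[rule_format, of 0] s by simp
  qed
  then have "norm (q 0 - p 0) \<le> 0" by (rule field_le_epsilon)
  then show "p 0 = (0, 0)" using q(1) by (simp add: gen_control_params_def)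
  show "fst (p s) \<le> fst (p t)" if st: "0 \<le> s" "s \<le> t" for s t
  proof (rule field_le_epsilon)
    fix e :: real assume "e > 0"
    then have "e / 2 > 0" by simp
    from param_equiv_close[OF q(2) this] obtain \<alpha> where
      \<alpha>: "\<alpha> \<in> time_changes" "\<forall>t\<ge>0. norm (q t - p (\<alpha> t)) \<le> e / 2" by blast
    have *: "strict_mono_on {0..} \<alpha>" "\<alpha> ` {0..} = {0..}"
      using \<alpha>(1) by (auto simp: time_changes_def bij_betw_def)
    have "s \<in> \<alpha> ` {0..}" "t \<in> \<alpha> ` {0..}" using * st by auto
    then obtain s' t' where s't': "s' \<ge> 0" "\<alpha> s' = s" "t' \<ge> 0" "\<alpha> t' = t" by auto
    have "s' \<le> t'"
    proof (rule ccontr)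
      assume "\<not> s' \<le> t'"
      then have "\<alpha> t' < \<alpha> s'" using s't' by (intro strict_mono_onD[OF *(1)]) auto
      then show False using st s't' by simp
    qed
    then have "fst (q s') \<le> fst (q t')" by (rule gen_control_params_mono[OF q(1) s't'(1)])
    moreover have "\<bar>fst (q s') - fst (p s)\<bar> \<le> e / 2" "\<bar>fst (q t') - fst (p t)\<bar> \<le> e / 2"
      unfolding s't'(2,4)[symmetric] by (intro fst_close \<alpha>(2)[rule_format] s't')+
    ultimately show "fst (p s) \<le> fst (p t) + e" by linarith
  qed
  obtain t where t: "t \<ge> 0" "fst (q t) > 1" using gen_control_params_reach[OF q(1)] by blast
  \<comment> \<open>Half of the excess over 1 is a tolerance that leaves
    \<open>fst (p (\<alpha> t))\<close> above 1.\<close>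
  then have "(fst (q t) - 1) / 2 > 0" by simp
  from param_equiv_close[OF q(2) this] obtain \<alpha> where
    \<alpha>: "\<alpha> \<in> time_changes" "\<forall>s\<ge>0. norm (q s - p (\<alpha> s)) \<le> (fst (q t) - 1) / 2" by blast
  have "\<bar>fst (q t) - fst (p (\<alpha> t))\<bar> \<le> (fst (q t) - 1) / 2"
    by (intro fst_close \<alpha>(2)[rule_format] t)
  then have "fst (q t) - fst (p (\<alpha> t)) \<le> (fst (q t) - 1) / 2" by (rule abs_le_D1)
  then have "fst (p (\<alpha> t)) > 1" using t(2) by (simp add: field_simps)
  moreover have "\<alpha> t \<ge> 0" using \<alpha>(1) t by (auto simp: time_changes_def bij_betw_def)
  ultimately show "\<exists>t\<ge>0. fst (p t) > 1" by blast
qed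

text \<open>The intermediate value theorem gives an \<open>s\<close> with
  \<open>fst (p s) = 1\<close>, which is positive and at most the final parameter. The set in the
  definition of \<open>final_param\<close> is closed and so contains its supremum, where the first
  component is therefore at most 1; monotonicity from \<open>s\<close> gives the converse.\<close>

lemma final_param_properties:
  assumes p: "p \<in> \<Union>gen_controls"
  shows "final_param p > 0" "fst (p (final_param p)) = 1"
proof -
  note rep = gen_control_representative[OF p]
  let ?S = "{s. 0 \<le> s \<and> fst (p s) \<le> 1}"
  obtain t where t: "t \<ge> 0" "fst (p t) > 1" using rep(4) by blast
  have cont: "continuous_on {0..t} (\<lambda>s. fst (p s))"
    by (intro continuous_intros continuous_on_subset[OF loc_abs_cont_imp_continuous_on[OF rep(1)]]) auto
  have St: "s \<le> t" if "s \<in> ?S" for s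
    using rep(3)[of t s] that t by force
  then have bdd: "bdd_above ?S" by (auto intro!: bdd_aboveI)
  obtain s where s: "0 \<le> s" "s \<le> t" "fst (p s) = 1"
    using IVT'[of "\<lambda>s. fst (p s)" 0 1 t] cont t rep(2) by auto
  have sT: "s \<le> final_param p"
    unfolding final_param_def by (rule cSup_upper[OF _ bdd]) (use s in auto)
  have "s \<noteq> 0" using s rep(2) by auto
  then show "final_param p > 0" using sT s by simp
  have "closed {r \<in> {0..t}. fst (p r) \<le> 1}"
    by (rule continuous_on_closed_Collect_le[OF cont]) auto
  moreover have "{r \<in> {0..t}. fst (p r) \<le> 1} = ?S" using St by auto
  ultimately have "final_param p \<in> ?S"
    unfolding final_param_def using bdd s by (intro closed_contains_Sup) auto
  then show "fst (p (final_param p)) = 1" using rep(3)[OF s(1) sT] s(3) by simp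
qed

section \<open>Perspective functions and reparametrization\<close>

text \<open>Measurability is not assumed, so the integrand of the generalized cost never has to be shown
  measurable.\<close>

lemma ereal_integral_mono:
  assumes "AE t in lebesgue. t \<in> A \<longrightarrow> h t \<le> k t"
  shows "ereal_integral A h \<le> ereal_integral A k"
proof -
  have "(\<integral>\<^sup>+t\<in>A. e2ennreal (h t) \<partial>lebesgue) \<le> (\<integral>\<^sup>+t\<in>A. e2ennreal (k t) \<partial>lebesgue)"
    by (rule nn_integral_mono_AE, use assms in eventually_elim)
       (auto simp: indicator_def intro: e2ennreal_mono)
  moreover have "(\<integral>\<^sup>+t\<in>A. e2ennreal (- k t) \<partial>lebesgue) \<le> (\<integral>\<^sup>+t\<in>A. e2ennreal (- h t) \<partial>lebesgue)"
    by (rule nn_integral_mono_AE, use assms in eventually_elim)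
       (auto simp: indicator_def intro: e2ennreal_mono)
  ultimately show ?thesis
    unfolding ereal_integral_def by (intro ereal_minus_mono) (simp_all add: less_eq_ennreal.rep_eq)
qed

lemma ereal_integral_cong:
  assumes "AE t in lebesgue. t \<in> A \<longrightarrow> h t = k t"
  shows "ereal_integral A h = ereal_integral A k"
proof (rule antisym)
  show "ereal_integral A h \<le> ereal_integral A k"
    by (rule ereal_integral_mono, use assms in eventually_elim) simp
  show "ereal_integral A k \<le> ereal_integral A h"
    by (rule ereal_integral_mono, use assms in eventually_elim) simp
qed

lemma ereal_integral_real:
  fixes h :: "real \<Rightarrow> real"
  assumes "h absolutely_integrable_on A"
  shows "ereal_integral A (\<lambda>t. ereal (h t)) = ereal (integral A h)"
proof -
  let ?h = "\<lambda>t. indicator A t * h t"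
  have int: "integrable lebesgue ?h" using assms by (simp add: set_integrable_def)
  have e: "(\<integral>\<^sup>+t\<in>A. e2ennreal (ereal (k t)) \<partial>lebesgue) = (\<integral>\<^sup>+t. ennreal (indicator A t * k t) \<partial>lebesgue)" for k
    by (intro nn_integral_cong) (auto simp: indicator_def e2ennreal_ereal)
  have fin: "(\<integral>\<^sup>+t. ennreal (?h t) \<partial>lebesgue) \<noteq> \<infinity>" "(\<integral>\<^sup>+t. ennreal (- ?h t) \<partial>lebesgue) \<noteq> \<infinity>"
    using int unfolding real_integrable_def by auto
  have "integral A h = (LINT t:A|lebesgue. h t)"
    using set_lebesgue_integral_eq_integral(2)[OF assms] by simp
  also have "\<dots> = (LINT t|lebesgue. ?h t)" by (simp add: set_lebesgue_integral_def)
  also have "\<dots> = enn2real (\<integral>\<^sup>+t. ennreal (?h t) \<partial>lebesgue) - enn2real (\<integral>\<^sup>+t. ennreal (- ?h t) \<partial>lebesgue)"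
    by (rule real_lebesgue_integral_def[OF int])
  finally have "ereal (integral A h) = enn2ereal (\<integral>\<^sup>+t. ennreal (?h t) \<partial>lebesgue) - enn2ereal (\<integral>\<^sup>+t. ennreal (- ?h t) \<partial>lebesgue)"
    using fin
    by (cases "\<integral>\<^sup>+t. ennreal (?h t) \<partial>lebesgue" rule: ennreal_cases;
        cases "\<integral>\<^sup>+t. ennreal (- ?h t) \<partial>lebesgue" rule: ennreal_cases)
      (auto simp: enn2ereal_ennreal)
  then show ?thesis
    unfolding ereal_integral_def e using e[of "\<lambda>t. - h t"] by simp
qed

section \<open>One-sided limits and perspective functions\<close>

lemma antimono_tendsto_at_right:
  fixes h :: "real \<Rightarrow> ereal"
  assumes anti: "\<And>s t. a < s \<Longrightarrow> s \<le> t \<Longrightarrow> h t \<le> h s"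
  shows "(h \<longlongrightarrow> (SUP s\<in>{a<..}. h s)) (at_right a)"
proof (rule order_tendstoI)
  fix c assume "c < (SUP s\<in>{a<..}. h s)"
  then obtain s where s: "a < s" "c < h s" by (auto simp: less_SUP_iff)
  have "c < h r" if "a < r" "r < s" for r
    using s anti[of r s] that by (meson order_less_imp_le order_less_le_trans)
  then show "\<forall>\<^sub>F r in at_right a. c < h r"
    using s(1) unfolding eventually_at_right_field by blast
next
  fix c assume c: "(SUP s\<in>{a<..}. h s) < c"
  have "h r < c" if "a < r" for r
    using c SUP_upper[of r "{a<..}" h] that by (meson greaterThan_iff order_le_less_trans)
  then show "\<forall>\<^sub>F r in at_right a. h r < c"
    unfolding eventually_at_right_field by (meson gt_ex)
qed

text \<open>Joint convexity of the perspective, on the segment from (a, w) to (b, w). The point w/c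
  is the convex combination of w/a and w/b with weights (1 - \<eta>) a/c and \<eta> b/c, and
  multiplication by \<open>c\<close> clears the denominators.\<close>

lemma perspective_convex:
  fixes \<phi> :: "'a::real_vector \<Rightarrow> real"
  assumes \<phi>: "convex_on UNIV \<phi>" and "a > 0" "b > 0" "0 < \<eta>" "\<eta> < 1"
  defines "c \<equiv> (1 - \<eta>) * a + \<eta> * b"
  shows "\<phi> (w /\<^sub>R c) * c \<le> (1 - \<eta>) * (\<phi> (w /\<^sub>R a) * a) + \<eta> * (\<phi> (w /\<^sub>R b) * b)"
proof -
  have c: "c > 0" unfolding c_def using assms(2-5) by (intro add_pos_pos mult_pos_pos) auto
  define t where "t = \<eta> * b / c"
  have t1: "1 - t = (1 - \<eta>) * a / c" using c unfolding t_def by (simp add: field_simps c_def)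
  have t: "0 \<le> t" "t \<le> 1"
  proof -
    show "0 \<le> t" using assms c by (simp add: t_def)
    have "0 \<le> 1 - t" unfolding t1 using assms c by simp
    then show "t \<le> 1" by simp
  qed
  have "(1 - t) * inverse a = (1 - \<eta>) / c" "t * inverse b = \<eta> / c"
    unfolding t1 unfolding t_def using assms(2,3) c by (simp_all add: field_simps)
  then have "(1 - t) *\<^sub>R (w /\<^sub>R a) + t *\<^sub>R (w /\<^sub>R b) = ((1 - \<eta>) / c) *\<^sub>R w + (\<eta> / c) *\<^sub>R w"
    by simp
  also have "\<dots> = w /\<^sub>R c"
    by (simp add: divide_inverse flip: scaleR_add_left ring_distribs)
  finally have "\<phi> (w /\<^sub>R c) \<le> (1 - t) * \<phi> (w /\<^sub>R a) + t * \<phi> (w /\<^sub>R b)"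
    using convex_onD[OF \<phi> t, of "w /\<^sub>R a" "w /\<^sub>R b"] by simp
  then have "\<phi> (w /\<^sub>R c) * c \<le> ((1 - t) * \<phi> (w /\<^sub>R a) + t * \<phi> (w /\<^sub>R b)) * c"
    using c by (intro mult_right_mono) auto
  also have "\<dots> = (1 - \<eta>) * (\<phi> (w /\<^sub>R a) * a) + \<eta> * (\<phi> (w /\<^sub>R b) * b)"
    unfolding t1 unfolding t_def using c by (simp add: field_simps)
  finally show ?thesis .
qed

text \<open>The limit is the recession function of \<phi>, possibly infinite. After subtraction of
  \<open>\<phi> 0\<close>, convexity makes the expression monotone in the parameter, so it tends to
  its supremum; the term \<open>\<phi> 0 * s\<close> that is added back tends to zero.\<close>

lemma perspective_tendsto:
  fixes \<phi> :: "'a::real_vector \<Rightarrow> real"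
  assumes \<phi>: "convex_on UNIV \<phi>"
  shows "\<exists>l. ((\<lambda>\<eta>. ereal (\<phi> (w /\<^sub>R \<eta>) * \<eta>)) \<longlongrightarrow> l) (at_right 0)"
proof -
  let ?h = "\<lambda>s. (\<phi> (w /\<^sub>R s) - \<phi> 0) * s"
  have anti: "?h t \<le> ?h s" if st: "0 < s" "s \<le> t" for s t
  proof -
    have "(1 - s / t) *\<^sub>R 0 + (s / t) *\<^sub>R (w /\<^sub>R s) = w /\<^sub>R t" using st by (simp add: divide_inverse)
    moreover have "\<phi> ((1 - s / t) *\<^sub>R 0 + (s / t) *\<^sub>R (w /\<^sub>R s)) \<le> (1 - s / t) * \<phi> 0 + (s / t) * \<phi> (w /\<^sub>R s)"
      by (rule convex_onD[OF \<phi>]) (use st in auto)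
    ultimately have "\<phi> (w /\<^sub>R t) \<le> (1 - s / t) * \<phi> 0 + (s / t) * \<phi> (w /\<^sub>R s)"
      by (simp only:)
    then have "\<phi> (w /\<^sub>R t) * t \<le> ((1 - s / t) * \<phi> 0 + (s / t) * \<phi> (w /\<^sub>R s)) * t"
      using st by (intro mult_right_mono) auto
    also have "\<dots> = (t - s) * \<phi> 0 + s * \<phi> (w /\<^sub>R s)" using st by (simp add: field_simps)
    finally show ?thesis by (simp add: algebra_simps)
  qed
  have "((\<lambda>s. ereal (?h s)) \<longlongrightarrow> (SUP s\<in>{0<..}. ereal (?h s))) (at_right 0)"
    by (rule antimono_tendsto_at_right) (use anti in simp)
  moreover have "((\<lambda>s. ereal (\<phi> 0 * s)) \<longlongrightarrow> ereal (\<phi> 0 * 0)) (at_right 0)"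
    by (intro tendsto_intros)
  ultimately have "((\<lambda>s. ereal (?h s) + ereal (\<phi> 0 * s)) \<longlongrightarrow> (SUP s\<in>{0<..}. ereal (?h s)) + ereal (\<phi> 0 * 0)) (at_right 0)"
    by (intro tendsto_add_ereal_general1) auto
  moreover have "ereal (?h s) + ereal (\<phi> 0 * s) = ereal (\<phi> (w /\<^sub>R s) * s)" for s
    by (simp add: algebra_simps)
  ultimately show ?thesis by auto
qed

text \<open>For positive \<open>v\<close> this is the perspective inequality. For
  \<open>v = 0\<close> that inequality is used with a small \<open>s\<close> in place of
  \<open>v\<close>, and \<open>s\<close> tends to 0: on the right \<open>lam\<close> appears as its
  defining limit, and the left side is continuous because \<open>c\<close> tends to
  \<open>\<eta> * \<psi>\<close>, which is positive.\<close>

lemma lam_perspective_bound: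
  assumes conv: "convex_on UNIV (L y)" and cont: "continuous_on UNIV (L y)"
    and "v \<ge> 0" "\<psi> > 0" "0 < \<eta>" "\<eta> < 1"
  defines "c \<equiv> (1 - \<eta>) * v + \<eta> * \<psi>"
  shows "ereal (L y (w /\<^sub>R c) * c) \<le> ereal (1 - \<eta>) * lam L y v w + ereal (\<eta> * (L y (w /\<^sub>R \<psi>) * \<psi>))"
proof (cases "v > 0")
  case True
  then show ?thesis
    using perspective_convex[OF conv True \<open>\<psi> > 0\<close> \<open>0 < \<eta>\<close> \<open>\<eta> < 1\<close>, of w]
    by (simp add: lam_def c_def)
next
  case False
  then have v: "v = 0" using \<open>v \<ge> 0\<close> by simp
  obtain l where l: "((\<lambda>\<eta>. ereal (L y (w /\<^sub>R \<eta>) * \<eta>)) \<longlongrightarrow> l) (at_right 0)"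
    using perspective_tendsto[OF conv] by blast
  then have lam: "lam L y v w = l" unfolding lam_def v by (simp add: tendsto_Lim)
  let ?c = "\<lambda>s. (1 - \<eta>) * s + \<eta> * \<psi>"
  have c0: "?c 0 \<noteq> 0" using assms by simp
  have tc: "(?c \<longlongrightarrow> ?c 0) (at_right 0)" by (intro tendsto_intros)
  have "((\<lambda>s. L y (w /\<^sub>R ?c s) * ?c s) \<longlongrightarrow> L y (w /\<^sub>R ?c 0) * ?c 0) (at_right 0)"
  proof (intro tendsto_mult tc)
    have "isCont (L y) (w /\<^sub>R ?c 0)" using cont by (simp add: continuous_on_eq_continuous_at)
    then show "((\<lambda>s. L y (w /\<^sub>R ?c s)) \<longlongrightarrow> L y (w /\<^sub>R ?c 0)) (at_right 0)"
      by (rule isCont_tendsto_compose) (intro tendsto_scaleR tendsto_inverse tc c0 tendsto_const)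
  qed
  then have lhs: "((\<lambda>s. ereal (L y (w /\<^sub>R ?c s) * ?c s)) \<longlongrightarrow> ereal (L y (w /\<^sub>R ?c 0) * ?c 0)) (at_right 0)"
    by (rule tendsto_ereal)
  have "((\<lambda>s. ereal (1 - \<eta>) * ereal (L y (w /\<^sub>R s) * s)) \<longlongrightarrow> ereal (1 - \<eta>) * l) (at_right 0)"
    by (rule tendsto_cmult_ereal[OF _ l]) simp
  then have rhs: "((\<lambda>s. ereal (1 - \<eta>) * ereal (L y (w /\<^sub>R s) * s) + ereal (\<eta> * (L y (w /\<^sub>R \<psi>) * \<psi>)))
      \<longlongrightarrow> ereal (1 - \<eta>) * l + ereal (\<eta> * (L y (w /\<^sub>R \<psi>) * \<psi>))) (at_right 0)"
    by (intro tendsto_add_ereal_general1) auto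
  have "ereal (L y (w /\<^sub>R ?c 0) * ?c 0) \<le> ereal (1 - \<eta>) * l + ereal (\<eta> * (L y (w /\<^sub>R \<psi>) * \<psi>))"
  proof (rule tendsto_le[OF _ rhs lhs])
    show "\<forall>\<^sub>F s in at_right 0. ereal (L y (w /\<^sub>R ?c s) * ?c s) \<le>
        ereal (1 - \<eta>) * ereal (L y (w /\<^sub>R s) * s) + ereal (\<eta> * (L y (w /\<^sub>R \<psi>) * \<psi>))"
      using eventually_at_right_less[of "0::real"]
      by eventually_elim (use perspective_convex[OF conv _ \<open>\<psi> > 0\<close> \<open>0 < \<eta>\<close> \<open>\<eta> < 1\<close>, of _ w] in simp)
  qed simp
  then show ?thesis unfolding lam c_def by (simp add: v)
qed

text \<open>Composition does not preserve absolute continuity in general, but a monotone Lipschitz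
  inner function sends non-overlapping intervals to non-overlapping ones and enlarges lengths by a
  bounded factor. Images may collapse or coincide, so they are indexed by the original
  intervals.\<close>

lemma abs_cont_on_compose_lipschitz:
  assumes F: "abs_cont_on c d F"
    and range: "\<And>t. a \<le> t \<Longrightarrow> t \<le> b \<Longrightarrow> c \<le> \<theta> t \<and> \<theta> t \<le> d"
    and lip: "\<And>s t. a \<le> s \<Longrightarrow> s \<le> t \<Longrightarrow> t \<le> b \<Longrightarrow> 0 \<le> \<theta> t - \<theta> s \<and> \<theta> t - \<theta> s \<le> C * (t - s)"
  shows "abs_cont_on a b (\<lambda>t. F (\<theta> t))"
  unfolding abs_cont_on_iff
proof (intro allI impI)
  fix \<epsilon> :: real assume "\<epsilon> > 0"
  then obtain \<delta> where \<delta>: "\<delta> > 0" and *: "\<forall>(I::(real \<times> real) set) s t. nonoverlapping c d I s t \<longrightarrow>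
     (\<Sum>i\<in>I. t i - s i) < \<delta> \<longrightarrow> (\<Sum>i\<in>I. norm (F (t i) - F (s i))) < \<epsilon>"
    using abs_cont_onD[OF F] by blast
  define B where "B = max C 1"
  have B: "B > 0" "C \<le> B" by (auto simp: B_def)
  have "(\<Sum>i\<in>D. norm (F (\<theta> (snd i)) - F (\<theta> (fst i)))) < \<epsilon>"
    if D: "nonoverlapping a b D fst snd" and len: "(\<Sum>i\<in>D. snd i - fst i) < \<delta> / B" for D
  proof -
    have D1: "finite D" "\<And>i. i \<in> D \<Longrightarrow> a \<le> fst i \<and> fst i \<le> snd i \<and> snd i \<le> b"
      using D by (auto simp: nonoverlapping_def)
    have "disjoint_family_on (\<lambda>i. {\<theta> (fst i)<..<\<theta> (snd i)}) D"
      unfolding disjoint_family_on_def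
    proof (intro ballI impI)
      fix i j assume ij: "i \<in> D" "j \<in> D" "i \<noteq> j"
      then have "{fst i<..<snd i} \<inter> {fst j<..<snd j} = {}"
        using D unfolding nonoverlapping_def disjoint_family_on_def by blast
      then have "fst i = snd i \<or> fst j = snd j \<or> snd i \<le> fst j \<or> snd j \<le> fst i"
        using D1(2)[OF ij(1)] D1(2)[OF ij(2)] by (auto simp: min_le_iff_disj le_max_iff_disj)
      then show "{\<theta> (fst i)<..<\<theta> (snd i)} \<inter> {\<theta> (fst j)<..<\<theta> (snd j)} = {}"
        using lip[of "snd i" "fst j"] lip[of "snd j" "fst i"] D1(2)[OF ij(1)] D1(2)[OF ij(2)] by auto
    qed
    then have no: "nonoverlapping c d D (\<lambda>i. \<theta> (fst i)) (\<lambda>i. \<theta> (snd i))"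
      unfolding nonoverlapping_def
    proof (intro conjI ballI D1(1))
      fix i assume "i \<in> D"
      note i = D1(2)[OF this]
      show "c \<le> \<theta> (fst i)" "\<theta> (fst i) \<le> \<theta> (snd i)" "\<theta> (snd i) \<le> d"
        using range[of "fst i"] range[of "snd i"] lip[of "fst i" "snd i"] i by auto
    qed
    have "(\<Sum>i\<in>D. \<theta> (snd i) - \<theta> (fst i)) \<le> (\<Sum>i\<in>D. B * (snd i - fst i))"
    proof (rule sum_mono)
      fix i assume "i \<in> D"
      note i = D1(2)[OF this]
      have "\<theta> (snd i) - \<theta> (fst i) \<le> C * (snd i - fst i)" using lip[of "fst i" "snd i"] i by auto
      also have "\<dots> \<le> B * (snd i - fst i)" using B i by (intro mult_right_mono) auto
      finally show "\<theta> (snd i) - \<theta> (fst i) \<le> B * (snd i - fst i)" .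
    qed
    also have "\<dots> = B * (\<Sum>i\<in>D. snd i - fst i)" by (simp add: sum_distrib_left)
    also have "\<dots> < B * (\<delta> / B)" using B len by (intro mult_strict_left_mono)
    finally have "(\<Sum>i\<in>D. \<theta> (snd i) - \<theta> (fst i)) < \<delta>" using B by simp
    with * no show ?thesis by blast
  qed
  moreover have "\<delta> / B > 0" using \<delta> B by simp
  ultimately show "\<exists>\<delta>>0. \<forall>D. nonoverlapping a b D fst snd \<longrightarrow>
     (\<Sum>i\<in>D. snd i - fst i) < \<delta> \<longrightarrow> (\<Sum>i\<in>D. norm (F (\<theta> (snd i)) - F (\<theta> (fst i)))) < \<epsilon>" by blast
qed

text \<open>The new clock \<Phi> is the primitive of \<omega>, and its inverse \<theta> is Lipschitz
  because \<omega> is at least \<open>c\<close> almost everywhere. The set \<open>S\<close> collects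
  the points off \<open>N\<close> at which \<Phi> has derivative \<omega>. Since \<open>S\<close>
  and its image both have full measure, what holds almost everywhere in the old parameter can be
  carried over to almost every time.\<close>

lemma reparametrization:
  fixes \<omega> :: "real \<Rightarrow> real"
  assumes T: "0 < T" and \<omega>: "\<omega> absolutely_integrable_on {0..T}" and N: "negligible N"
    and c: "c > 0" "\<forall>s\<in>{0..T} - N. c \<le> \<omega> s" and one: "integral {0..T} \<omega> = 1"
  shows "\<exists>\<Phi> \<theta> S. S \<subseteq> {0<..<T} - N \<and> negligible ({0..T} - S) \<and> S \<in> sets lebesgue \<and>
    \<Phi> ` S \<subseteq> {0<..<1} \<and> negligible ({0..1} - \<Phi> ` S) \<and> inj_on \<Phi> S \<and>
    (\<forall>s\<in>S. \<theta> (\<Phi> s) = s \<and> (\<Phi> has_real_derivative \<omega> s) (at s) \<and>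
       (\<theta> has_real_derivative inverse (\<omega> s)) (at (\<Phi> s))) \<and>
    \<theta> 0 = 0 \<and> \<theta> 1 = T \<and> (\<forall>t. 0 \<le> t \<longrightarrow> t \<le> 1 \<longrightarrow> 0 \<le> \<theta> t \<and> \<theta> t \<le> T) \<and>
    (\<forall>s t. 0 \<le> s \<longrightarrow> s \<le> t \<longrightarrow> t \<le> 1 \<longrightarrow> 0 \<le> \<theta> t - \<theta> s \<and> \<theta> t - \<theta> s \<le> inverse c * (t - s))"
proof -
  define \<Phi> where "\<Phi> s = integral {0..s} \<omega>" for s
  define \<theta> where "\<theta> = inv_into {0..T} \<Phi>"
  have int: "\<omega> integrable_on {0..T}" using \<omega> by (rule set_lebesgue_integral_eq_integral(1))
  have ge: "c * (t - s) \<le> \<Phi> t - \<Phi> s" if "0 \<le> s" "s \<le> t" "t \<le> T" for s t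
  proof -
    have comb: "integral {0..s} \<omega> + integral {s..t} \<omega> = integral {0..t} \<omega>"
      by (rule Henstock_Kurzweil_Integration.integral_combine)
        (use that integrable_on_subinterval[OF int] in auto)
    have ist: "\<omega> integrable_on {s..t}"
      by (rule integrable_on_subinterval[OF int]) (use that in auto)
    \<comment> \<open>Redefinition on the null set makes the lower bound \<open>c\<close> hold at
      every point, as \<open>has_integral_le\<close> requires.\<close>
    have i1: "((\<lambda>r. if r \<in> N then c else \<omega> r) has_integral integral {s..t} \<omega>) {s..t}"
      by (rule has_integral_spike[OF N _ integrable_integral[OF ist]]) auto
    have i2: "((\<lambda>_. c) has_integral (t - s) *\<^sub>R c) {s..t}"
      using has_integral_const_real[of c s t] that by simp
    have "(t - s) *\<^sub>R c \<le> integral {s..t} \<omega>"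
      by (rule has_integral_le[OF i2 i1]) (use c(2) that in auto)
    then show ?thesis using comb unfolding \<Phi>_def by (simp add: mult.commute)
  qed
  have strict: "\<Phi> s < \<Phi> t" if "0 \<le> s" "s < t" "t \<le> T" for s t
  proof -
    have "0 < c * (t - s)" using c that by simp
    then show ?thesis using ge[of s t] that by linarith
  qed
  have inj: "inj_on \<Phi> {0..T}"
    by (rule linorder_inj_onI) (use strict in fastforce)+
  have \<Phi>0: "\<Phi> 0 = 0" by (simp add: \<Phi>_def)
  have \<Phi>T: "\<Phi> T = 1" using one by (simp add: \<Phi>_def)
  have cont: "continuous_on {0..T} \<Phi>" unfolding \<Phi>_def by (rule indefinite_integral_continuous_1[OF int])
  have surj: "t \<in> \<Phi> ` {0..T}" if "0 \<le> t" "t \<le> 1" for t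
    using IVT'[of \<Phi> 0 t T] cont \<Phi>0 \<Phi>T that T by force
  have \<theta>: "0 \<le> \<theta> t" "\<theta> t \<le> T" "\<Phi> (\<theta> t) = t" if "0 \<le> t" "t \<le> 1" for t
    using inv_into_into[OF surj[OF that]] f_inv_into_f[OF surj[OF that]] by (auto simp: \<theta>_def)
  have \<theta>\<Phi>: "\<theta> (\<Phi> s) = s" if "s \<in> {0..T}" for s
    unfolding \<theta>_def by (rule inv_into_f_f[OF inj that])
  have lip: "0 \<le> \<theta> t - \<theta> s \<and> \<theta> t - \<theta> s \<le> inverse c * (t - s)" if st: "0 \<le> s" "s \<le> t" "t \<le> 1" for s t
  proof -
    have s: "0 \<le> \<theta> s" "\<theta> s \<le> T" "\<Phi> (\<theta> s) = s" using \<theta>[of s] st by auto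
    have t: "0 \<le> \<theta> t" "\<theta> t \<le> T" "\<Phi> (\<theta> t) = t" using \<theta>[of t] st by auto
    have le: "\<theta> s \<le> \<theta> t"
      using strict[of "\<theta> t" "\<theta> s"] s t st by (cases "\<theta> s \<le> \<theta> t") auto
    have "c * (\<theta> t - \<theta> s) \<le> t - s" using ge[OF s(1) le t(2)] s t by simp
    then show ?thesis using le c by (simp add: field_simps)
  qed
  obtain M where M: "negligible M" "\<forall>t\<in>{0<..<T} - M. (\<Phi> has_vector_derivative \<omega> t) (at t)"
    using lebesgue_differentiation[OF int] unfolding \<Phi>_def by blast
  define S where "S = {0<..<T} - (N \<union> M)"
  have neg: "negligible (N \<union> M)" using N M by simp
  have ST: "negligible ({0..T} - S)"
    by (rule negligible_subset[of "N \<union> M \<union> {0, T}"]) (use neg in \<open>auto simp: S_def less_le\<close>)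
  have Sleb: "S \<in> sets lebesgue"
    unfolding S_def by (intro sets.Diff negligible_imp_sets[OF neg]) auto
  have dS: "(\<Phi> has_real_derivative \<omega> s) (at s)" if "s \<in> S" for s
    using M(2) that unfolding has_real_derivative_iff_has_vector_derivative S_def by blast
  have injS: "inj_on \<Phi> S" by (rule inj_on_subset[OF inj]) (auto simp: S_def)
  have S01: "\<Phi> ` S \<subseteq> {0<..<1}"
  proof clarify
    fix s assume "s \<in> S"
    then have "0 < s" "s < T" by (auto simp: S_def)
    then show "\<Phi> s \<in> {0<..<1}" using strict[of 0 s] strict[of s T] \<Phi>0 \<Phi>T by simp
  qed
  have cS: "c \<le> \<omega> s" if "s \<in> S" for s using c(2) that by (auto simp: S_def)
  have \<omega>S: "\<omega> absolutely_integrable_on S"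
    by (rule set_integrable_subset[OF \<omega> Sleb]) (auto simp: S_def)
  \<comment> \<open>a change of variables with integrand \<open>1\<close> shows that \<open>\<Phi> ` S\<close> has full measure\<close>
  have "integral S \<omega> = integral {0..T} \<omega>"
    by (rule integral_spike_set) (auto intro: negligible_subset[OF ST] simp: S_def)
  then have "(\<lambda>s. \<bar>\<omega> s\<bar> * 1) absolutely_integrable_on S \<and> integral S (\<lambda>s. \<bar>\<omega> s\<bar> * 1) = 1"
    using \<omega>S one set_integrable_abs[OF \<omega>S] integral_cong[of S "\<lambda>s. \<bar>\<omega> s\<bar>" \<omega>] cS c(1) by fastforce
  then have "(\<lambda>_. 1 :: real) absolutely_integrable_on \<Phi> ` S \<and> integral (\<Phi> ` S) (\<lambda>_. 1 :: real) = 1"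
    using has_absolute_integral_change_of_variables_1'[OF Sleb _ injS, of \<omega> "\<lambda>_. 1" 1] dS
    by (simp add: has_field_derivative_at_within)
  then have one': "(\<lambda>_. 1 :: real) integrable_on \<Phi> ` S" "integral (\<Phi> ` S) (\<lambda>_. 1 :: real) = 1"
    using set_lebesgue_integral_eq_integral(1) by blast+
  then have lm: "\<Phi> ` S \<in> lmeasurable" by (simp add: lmeasurable_iff_integrable_on)
  have "measure lebesgue ({0..1} - \<Phi> ` S) = measure lebesgue {0..1::real} - measure lebesgue (\<Phi> ` S)"
    by (rule measurable_measure_Diff) (use lm S01 in \<open>auto simp: fmeasurableD\<close>)
  also have "\<dots> = 0" using lmeasure_integral[OF lm] one'(2) by simp
  finally have neg1: "negligible ({0..1} - \<Phi> ` S)"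
    unfolding negligible_iff_measure by (auto intro!: fmeasurable.Diff lm)
  have contlip: "(inverse c)-lipschitz_on {0..1} \<theta>"
  proof (rule lipschitz_onI)
    fix s t :: real assume "s \<in> {0..1}" "t \<in> {0..1}"
    then show "dist (\<theta> s) (\<theta> t) \<le> inverse c * dist s t"
      using lip[of s t] lip[of t s] by (cases "s \<le> t") (auto simp: dist_real_def)
  qed (use c in simp)
  have d\<theta>: "(\<theta> has_real_derivative inverse (\<omega> s)) (at (\<Phi> s))" if s: "s \<in> S" for s
  proof (rule DERIV_inverse_function[where f = \<Phi> and a = 0 and b = 1])
    have ts: "\<theta> (\<Phi> s) = s" using s by (intro \<theta>\<Phi>) (auto simp: S_def)
    show "(\<Phi> has_real_derivative \<omega> s) (at (\<theta> (\<Phi> s)))" unfolding ts by (rule dS[OF s])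
    show "\<omega> s \<noteq> 0" using cS[OF s] c by simp
    show "0 < \<Phi> s" "\<Phi> s < 1" using S01 s by auto
    show "\<And>y. 0 < y \<Longrightarrow> y < 1 \<Longrightarrow> \<Phi> (\<theta> y) = y" using \<theta>(3) by simp
    show "isCont \<theta> (\<Phi> s)"
      by (rule continuous_on_interior[OF lipschitz_on_continuous_on[OF contlip]]) (use S01 s in auto)
  qed
  show ?thesis
  proof (rule exI[of _ \<Phi>], rule exI[of _ \<theta>], rule exI[of _ S], intro conjI)
    show "S \<subseteq> {0<..<T} - N" by (auto simp: S_def)
    show "\<forall>s\<in>S. \<theta> (\<Phi> s) = s \<and> (\<Phi> has_real_derivative \<omega> s) (at s) \<and>
        (\<theta> has_real_derivative inverse (\<omega> s)) (at (\<Phi> s))"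
    proof (intro ballI conjI)
      fix s assume s: "s \<in> S"
      show "\<theta> (\<Phi> s) = s" using s by (intro \<theta>\<Phi>) (auto simp: S_def)
      show "(\<Phi> has_real_derivative \<omega> s) (at s)" by (rule dS[OF s])
      show "(\<theta> has_real_derivative inverse (\<omega> s)) (at (\<Phi> s))" by (rule d\<theta>[OF s])
    qed
    show "\<theta> 0 = 0" "\<theta> 1 = T" using \<theta>\<Phi>[of 0] \<theta>\<Phi>[of T] \<Phi>0 \<Phi>T T by simp_all
    show "\<forall>t. 0 \<le> t \<longrightarrow> t \<le> 1 \<longrightarrow> 0 \<le> \<theta> t \<and> \<theta> t \<le> T" using \<theta>(1,2) by blast
    show "\<forall>s t. 0 \<le> s \<longrightarrow> s \<le> t \<longrightarrow> t \<le> 1 \<longrightarrow> 0 \<le> \<theta> t - \<theta> s \<and> \<theta> t - \<theta> s \<le> inverse c * (t - s)"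
      using lip by blast
  qed (use ST Sleb S01 neg1 injS in simp_all)
qed

section \<open>Driftless systems\<close>

text \<open>Without drift, one curve solves the equation for every time component \<open>v\<close>;
  this is what permits the change of clock.\<close>

lemma solves_on_driftlessI:
  fixes g :: "'k::finite \<Rightarrow> real^'n \<Rightarrow> real^'n"
  assumes driftless: "\<And>x. f x = 0"
    and y: "abs_cont_on 0 T y" "y 0 = x0" and N: "negligible N"
    and y': "\<And>t. t \<in> {0..T} - N \<Longrightarrow> (y has_vector_derivative (\<Sum>i\<in>UNIV. (w t $ i) *\<^sub>R g i (y t))) (at t)"
  shows "solves_on f g x0 v w T y"
proof -
  have "negligible {t \<in> {0..T}. \<not> (y has_vector_derivative
      (v t *\<^sub>R f (y t) + (\<Sum>i\<in>UNIV. (w t $ i) *\<^sub>R g i (y t)))) (at t)}"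
    by (rule negligible_subset[OF N]) (use y' driftless in auto)
  then show ?thesis
    unfolding solves_on_def using y by (subst AE_lebesgue_on_iff_negligible) auto
qed

lemma lagrangian_bound:
  fixes x :: "real \<Rightarrow> 'a::topological_space" and L :: "'a \<Rightarrow> 'b::euclidean_space \<Rightarrow> real"
  assumes L_cont: "continuous_on UNIV (\<lambda>(x, u). L x u)" and "continuous_on {a..b} x"
  shows "\<exists>M. \<forall>t\<in>{a..b}. \<forall>z. norm z \<le> B \<longrightarrow> \<bar>L (x t) z\<bar> \<le> M"
proof -
  let ?K = "x ` {a..b} \<times> cball 0 B"
  have "compact ((\<lambda>(x, u). L x u) ` ?K)"
    by (intro compact_continuous_image continuous_on_subset[OF L_cont] compact_Times compact_Icc compact_cball assms) auto
  then have "bounded ((\<lambda>(x, u). L x u) ` ?K)" by (rule compact_imp_bounded)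
  then obtain M where M: "\<forall>r\<in>(\<lambda>(x, u). L x u) ` ?K. norm r \<le> M"
    unfolding bounded_iff by blast
  show ?thesis
  proof (intro exI[of _ M] ballI allI impI)
    fix t and z :: 'b assume "t \<in> {a..b}" "norm z \<le> B"
    then have "(x t, z) \<in> ?K" by simp
    from M[rule_format, OF imageI[OF this]] show "\<bar>L (x t) z\<bar> \<le> M" by simp
  qed
qed

text \<open>The control at time \<open>t\<close> is the quotient of \<open>w\<close> by \<omega> at
  the old parameter \<open>\<theta> t\<close>. By the chain rule its primitive is \<open>W\<close>
  and its trajectory is \<open>y\<close>, both composed with \<theta>. Substituting
  \<open>t = \<Phi> s\<close> turns the cost into an integral over the old parameter.\<close>

lemma ordinary_control_of_reparametrization:
  fixes f :: "real^'n \<Rightarrow> real^'n" and g :: "'k::finite \<Rightarrow> real^'n \<Rightarrow> real^'n"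
    and L :: "real^'n \<Rightarrow> real^'k \<Rightarrow> real"
  assumes lip: "\<And>i. local_lipschitz (UNIV :: real set) UNIV (\<lambda>_. g i)"
    and driftless: "\<And>x. f x = 0"
    and L_cont: "continuous_on UNIV (\<lambda>(x, u). L x u)"
    and T: "0 < T" and W: "abs_cont_on 0 T W" "W 0 = 0"
    and N: "negligible N" and W': "\<And>s. s \<in> {0..T} - N \<Longrightarrow> (W has_vector_derivative w s) (at s)"
    and y: "solves_on f g x0 v w T y"
    and \<omega>: "\<omega> absolutely_integrable_on {0..T}" "c > 0" "\<And>s. s \<in> {0..T} - N \<Longrightarrow> c \<le> \<omega> s"
      "integral {0..T} \<omega> = 1"
    and B: "\<And>s. s \<in> {0..T} - N \<Longrightarrow> norm (w s) \<le> B * \<omega> s"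
  shows "\<exists>u. set_integrable lebesgue {0..1} u \<and> traj_defined f g x0 (\<lambda>_. 1) u 1 \<and>
     traj f g x0 (\<lambda>_. 1) u 1 = y T \<and>
     (\<lambda>s. L (y s) (w s /\<^sub>R \<omega> s) * \<omega> s) absolutely_integrable_on {0..T} \<and>
     gen_cost f g L x0 (graph_control u) = ereal (integral {0..T} (\<lambda>s. L (y s) (w s /\<^sub>R \<omega> s) * \<omega> s))"
proof -
  define N' where "N' = {t \<in> {0..T}. \<not> (y has_vector_derivative (\<Sum>i\<in>UNIV. (w t $ i) *\<^sub>R g i (y t))) (at t)}"
  have "negligible N'"
    using y driftless unfolding solves_on_def N'_def
    by (subst AE_lebesgue_on_iff_negligible[symmetric]) auto
  then have NN: "negligible (N \<union> N')" using N by simp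
  have acy: "abs_cont_on 0 T y" "y 0 = x0" using y by (auto simp: solves_on_def)
  obtain \<Phi> \<theta> S where S: "S \<subseteq> {0<..<T} - (N \<union> N')" "negligible ({0..T} - S)" "S \<in> sets lebesgue"
    and \<Phi>S: "\<Phi> ` S \<subseteq> {0<..<1}" "negligible ({0..1} - \<Phi> ` S)" "inj_on \<Phi> S"
    and onS: "\<forall>s\<in>S. \<theta> (\<Phi> s) = s \<and> (\<Phi> has_real_derivative \<omega> s) (at s) \<and>
       (\<theta> has_real_derivative inverse (\<omega> s)) (at (\<Phi> s))"
    and \<theta>01: "\<theta> 0 = 0" "\<theta> 1 = T"
    and \<theta>r: "\<forall>t. 0 \<le> t \<longrightarrow> t \<le> 1 \<longrightarrow> 0 \<le> \<theta> t \<and> \<theta> t \<le> T"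
    and \<theta>l: "\<forall>s t. 0 \<le> s \<longrightarrow> s \<le> t \<longrightarrow> t \<le> 1 \<longrightarrow> 0 \<le> \<theta> t - \<theta> s \<and> \<theta> t - \<theta> s \<le> inverse c * (t - s)"
  proof -
    have "\<forall>s\<in>{0..T} - (N \<union> N'). c \<le> \<omega> s" using \<omega>(3) by blast
    from reparametrization[OF T \<omega>(1) NN \<omega>(2) this \<omega>(4)] show thesis
      by (elim exE conjE) (rule that)
  qed
  note \<theta>\<Phi> = onS[rule_format, THEN conjunct1]
    and d\<Phi> = onS[rule_format, THEN conjunct2, THEN conjunct1]
    and d\<theta> = onS[rule_format, THEN conjunct2, THEN conjunct2]
  define R where "R = \<Phi> ` S"
  \<comment> \<open>The value 0 off the full-measure set \<open>R\<close> keeps \<open>u\<close>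
    bounded everywhere.\<close>
  define u where "u t = (if t \<in> R then w (\<theta> t) /\<^sub>R \<omega> (\<theta> t) else 0)" for t
  define x where "x t = y (\<theta> t)" for t
  define U where "U t = W (\<theta> t)" for t
  have negR: "negligible ({0..1} - R)" and R01: "R \<subseteq> {0<..<1}" using \<Phi>S by (auto simp: R_def)
  have \<omega>S: "\<omega> s > 0" if "s \<in> S" for s
  proof -
    have "c \<le> \<omega> s" by (rule \<omega>(3)) (use S(1) that in auto)
    then show ?thesis using \<omega>(2) by linarith
  qed
  have u\<Phi>: "u (\<Phi> s) = w s /\<^sub>R \<omega> s" if "s \<in> S" for s using that by (simp add: u_def R_def \<theta>\<Phi>)
  have d\<theta>v: "(\<theta> has_vector_derivative inverse (\<omega> s)) (at (\<Phi> s))" if "s \<in> S" for s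
    using d\<theta>[OF that] by (simp add: has_real_derivative_iff_has_vector_derivative)
  have dU: "(U has_vector_derivative u t) (at t)" if t: "t \<in> R" for t
  proof -
    obtain s where s: "s \<in> S" "t = \<Phi> s" using t by (auto simp: R_def)
    have "(W has_vector_derivative w s) (at (\<theta> (\<Phi> s)))"
      unfolding \<theta>\<Phi>[OF s(1)] by (rule W') (use s(1) S(1) in auto)
    from vector_diff_chain_at[OF d\<theta>v[OF s(1)] this]
    show ?thesis unfolding s(2) u\<Phi>[OF s(1)] U_def o_def .
  qed
  have dx: "(x has_vector_derivative (\<Sum>i\<in>UNIV. (u t $ i) *\<^sub>R g i (x t))) (at t)" if t: "t \<in> R" for t
  proof -
    obtain s where s: "s \<in> S" "t = \<Phi> s" using t by (auto simp: R_def)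
    have "(y has_vector_derivative (\<Sum>i\<in>UNIV. (w s $ i) *\<^sub>R g i (y s))) (at (\<theta> (\<Phi> s)))"
      unfolding \<theta>\<Phi>[OF s(1)] using s(1) S(1) by (auto simp: N'_def)
    from vector_diff_chain_at[OF d\<theta>v[OF s(1)] this]
    show ?thesis unfolding s(2) u\<Phi>[OF s(1)] x_def o_def \<theta>\<Phi>[OF s(1)]
      by (simp add: scaleR_sum_right)
  qed
  have acU: "abs_cont_on 0 1 U"
    unfolding U_def by (rule abs_cont_on_compose_lipschitz[OF W(1) \<theta>r[rule_format] \<theta>l[rule_format]])
  have acx: "abs_cont_on 0 1 x"
    unfolding x_def by (rule abs_cont_on_compose_lipschitz[OF acy(1) \<theta>r[rule_format] \<theta>l[rule_format]])
  have x0: "x 0 = x0" and U0: "U 0 = 0" using acy(2) W(2) by (simp_all add: x_def U_def \<theta>01)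
  have int_u: "u absolutely_integrable_on {0..1}"
    by (rule abs_cont_on_fundamental_theorem(1)[OF acU _ negR]) (use dU in auto)
  have U_int: "(u has_integral U t) {0..t}" if "0 \<le> t" "t \<le> 1" for t
    using abs_cont_on_fundamental_theorem(2)[OF acU _ negR, of u 0 t] dU that U0 by auto
  let ?p = "graph_control u"
  have graph: "?p t = (t, U t)" if t: "0 \<le> t" "t \<le> 1" for t
  proof -
    have "u absolutely_integrable_on {0..t}"
      by (rule absolutely_integrable_on_subinterval[OF int_u]) (use t in auto)
    from set_lebesgue_integral_eq_integral(2)[OF this] integral_unique[OF U_int[OF t]]
    show ?thesis using t by (simp add: graph_control_def min_def)
  qed
  have vd: "vdot ?p t = 1" for t
    unfolding vdot_def graph_control_def by (simp add: vector_derivative_at has_vector_derivative_id)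
  \<comment> \<open>The graph control follows \<open>U\<close> only on \<open>{0..1}\<close>, so the
    derivatives are compared inside the open interval.\<close>
  have wd: "wdot ?p t = u t" if t: "t \<in> R" for t
    unfolding wdot_def
  proof (rule vector_derivative_at)
    show "((\<lambda>s. snd (?p s)) has_vector_derivative u t) (at t)"
      by (rule has_vector_derivative_transform_within_open[OF dU[OF t], of "{0<..<1}"])
        (use t R01 graph in auto)
  qed
  have fp: "final_param ?p = 1"
  proof -
    have "{s. 0 \<le> s \<and> fst (?p s) \<le> 1} = {0..1}" by (auto simp: graph_control_def)
    then show ?thesis by (simp add: final_param_def)
  qed
  \<comment> \<open>The curve \<open>x\<close> has to solve two systems: that of the ordinary
    control and that of its graph control, whose \<open>wdot\<close> is known to equal
    \<open>u\<close> only on \<open>R\<close>.\<close>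
  have sol1: "solves_on f g x0 v' u 1 x" for v'
    by (rule solves_on_driftlessI[OF driftless acx x0 negR]) (use dx in auto)
  have sol2: "solves_on f g x0 (vdot ?p) (wdot ?p) 1 x"
    by (rule solves_on_driftlessI[OF driftless acx x0 negR]) (use dx wd in auto)
  have int_w: "wdot ?p absolutely_integrable_on {0..1}"
    by (rule absolutely_integrable_spike[OF int_u negR]) (use wd in auto)
  have tr1: "traj f g x0 (\<lambda>_. 1) u 1 = y T"
    using traj_eq[OF lip driftless int_u sol1, of 1] by (simp add: x_def \<theta>01)
  have tr2: "traj f g x0 (vdot ?p) (wdot ?p) t = x t" if "t \<in> {0..1}" for t
    by (rule traj_eq[OF lip driftless int_w sol2 that])
  define h where "h t = L (x t) (u t)" for t
  have contx: "continuous_on {0..1} x" by (rule abs_cont_on_imp_continuous_on[OF acx])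
  have uB: "norm (u t) \<le> max B 0" for t
  proof (cases "t \<in> R")
    case True
    then obtain s where s: "s \<in> S" "t = \<Phi> s" by (auto simp: R_def)
    have "norm (w s) \<le> B * \<omega> s" by (rule B) (use s(1) S(1) in auto)
    then have "norm (w s) / \<omega> s \<le> B" using \<omega>S[OF s(1)] by (simp add: pos_divide_le_eq)
    then show ?thesis unfolding s(2) u\<Phi>[OF s(1)] using \<omega>S[OF s(1)] by (simp add: divide_inverse mult.commute)
  qed (simp add: u_def)
  obtain M where M: "\<forall>t\<in>{0..1}. \<forall>z. norm z \<le> max B 0 \<longrightarrow> \<bar>L (x t) z\<bar> \<le> M"
    using lagrangian_bound[OF L_cont contx] by blast
  \<comment> \<open>Trajectory and control range in a compact set, where \<open>L\<close> is bounded
    by \<open>M\<close>, so integrability reduces to measurability.\<close>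
  have h: "h absolutely_integrable_on {0..1}"
  proof (rule measurable_bounded_by_integrable_imp_absolutely_integrable)
    have mu: "u \<in> borel_measurable (lebesgue_on {0..1})"
      by (rule absolutely_integrable_imp_borel_measurable[OF int_u]) simp
    have mx: "x \<in> borel_measurable (lebesgue_on {0..1})"
      by (rule continuous_imp_measurable_on_sets_lebesgue[OF contx]) auto
    have "(\<lambda>t. (\<lambda>(x, u). L x u) (x t, u t)) \<in> borel_measurable (lebesgue_on {0..1})"
      by (rule measurable_compose[OF borel_measurable_Pair[OF mx mu] borel_measurable_continuous_onI[OF L_cont]])
    then show "h \<in> borel_measurable (lebesgue_on {0..1})" by (simp add: h_def[abs_def])
    show "(\<lambda>_. M) integrable_on {0..1::real}" by (rule integrable_const_ivl)
    show "norm (h t) \<le> M" if "t \<in> {0..1}" for t using M that uB by (simp add: h_def)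
  qed auto
  have "gen_cost f g L x0 ?p = ereal_integral {0..1} (\<lambda>t. ereal (h t))"
    unfolding gen_cost_def fp
  proof (rule ereal_integral_cong)
    have "{0..1} - R \<in> null_sets lebesgue" using negR by (simp add: negligible_iff_null_sets)
    from AE_not_in[OF this]
    show "AE t in lebesgue. t \<in> {0..1} \<longrightarrow>
        lam L (traj f g x0 (vdot ?p) (wdot ?p) t) (vdot ?p t) (wdot ?p t) = ereal (h t)"
      by eventually_elim (use tr2 in \<open>auto simp: lam_def h_def vd wd\<close>)
  qed
  also have "\<dots> = ereal (integral {0..1} h)" by (rule ereal_integral_real[OF h])
  finally have cost: "gen_cost f g L x0 ?p = ereal (integral {0..1} h)" .
  let ?H = "\<lambda>s. L (y s) (w s /\<^sub>R \<omega> s) * \<omega> s"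
  \<comment> \<open>\<open>R\<close> is Lebesgue measurable as the complement in
    \<open>{0..1}\<close> of a null set.\<close>
  have "{0..1} - ({0..1} - R) \<in> sets lebesgue"
    by (intro sets.Diff negligible_imp_sets[OF negR]) auto
  moreover have "{0..1} - ({0..1} - R) = R" using R01 by auto
  ultimately have Rleb: "R \<in> sets lebesgue" by (simp only:)
  have hR: "h absolutely_integrable_on R"
    by (rule set_integrable_subset[OF h Rleb]) (use R01 in auto)
  have "integral R h = integral {0..1} h"
  proof (rule integral_spike_set)
    show "negligible {t \<in> R - {0..1}. h t \<noteq> 0}"
      by (rule negligible_subset[OF negligible_empty]) (use R01 in force)
    show "negligible {t \<in> {0..1} - R. h t \<noteq> 0}" by (rule negligible_subset[OF negR]) auto
  qed
  \<comment> \<open>Change of variables \<open>t = \<Phi> s\<close>; the modulus disappears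
    afterwards because \<omega> is positive on \<open>S\<close>.\<close>
  then have "(\<lambda>s. \<bar>\<omega> s\<bar> * h (\<Phi> s)) absolutely_integrable_on S \<and>
      integral S (\<lambda>s. \<bar>\<omega> s\<bar> * h (\<Phi> s)) = integral {0..1} h"
    using has_absolute_integral_change_of_variables_1'[OF S(3) has_field_derivative_at_within[OF d\<Phi>] \<Phi>S(3), of h "integral {0..1} h"]
      hR unfolding R_def by blast
  moreover have "\<bar>\<omega> s\<bar> * h (\<Phi> s) = ?H s" if "s \<in> S" for s
    using \<omega>S[OF that] by (simp add: h_def x_def \<theta>\<Phi>[OF that] u\<Phi>[OF that] mult.commute)
  ultimately have HS: "?H absolutely_integrable_on S" "integral S ?H = integral {0..1} h"
    by (auto simp: cong: set_integrable_cong integral_cong)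
  have spike: "negligible {s \<in> S - {0..T}. ?H s \<noteq> 0}" "negligible {s \<in> {0..T} - S. ?H s \<noteq> 0}"
    by (rule negligible_subset[OF negligible_empty], use S(1) in force)
      (rule negligible_subset[OF S(2)], auto)
  have "?H absolutely_integrable_on {0..T}"
    using HS(1) absolutely_integrable_spike_set_eq[OF spike] by blast
  moreover have "integral {0..T} ?H = integral S ?H"
    by (rule integral_spike_set[OF spike(2,1)])
  ultimately show ?thesis
    using int_u sol1 tr1 cost HS(2) unfolding traj_defined_def by (intro exI[of _ u]) auto
qed

text \<open>The estimate bounds the generalized cost, which may be infinite, from below by a real
  number, so only a real integrable function has to be compared with \<open>lam\<close>. The
  constant \<open>M\<close> bounds \<open>L\<close> along the trajectory at controls of norm at most
  \<open>m\<close>. It is independent of \<eta>, so its contribution vanishes as \<eta> tends to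
  0.\<close>

lemma gen_cost_approximation:
  fixes f :: "real^'n \<Rightarrow> real^'n" and g :: "'k::finite \<Rightarrow> real^'n \<Rightarrow> real^'n"
    and L :: "real^'n \<Rightarrow> real^'k \<Rightarrow> real"
  assumes lip: "\<And>i. local_lipschitz (UNIV :: real set) UNIV (\<lambda>_. g i)"
    and driftless: "\<And>x. f x = 0"
    and L_cont: "continuous_on UNIV (\<lambda>(x, u). L x u)"
    and L_conv: "\<And>x. convex_on UNIV (L x)"
    and p: "p \<in> steering_gen_controls f g x0 x1"
  shows "\<exists>M. \<forall>\<eta>. 0 < \<eta> \<longrightarrow> \<eta> < 1 \<longrightarrow> (\<exists>u I. set_integrable lebesgue {0..1} u \<and>
     traj_defined f g x0 (\<lambda>_. 1) u 1 \<and> traj f g x0 (\<lambda>_. 1) u 1 = x1 \<and>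
     gen_cost f g L x0 (graph_control u) = ereal I \<and>
     ereal ((I - \<eta> * M) / (1 - \<eta>)) \<le> gen_cost f g L x0 p)"
proof -
  define T where "T = final_param p"
  have pg: "p \<in> \<Union>gen_controls" and "traj_defined f g x0 (vdot p) (wdot p) T"
    and x1: "traj f g x0 (vdot p) (wdot p) T = x1"
    using p by (auto simp: steering_gen_controls_def T_def)
  then obtain y where y: "solves_on f g x0 (vdot p) (wdot p) T y"
    unfolding traj_defined_def by blast
  note rep = gen_control_representative[OF pg]
  have T: "T > 0" "fst (p T) = 1" using final_param_properties[OF pg] by (simp_all add: T_def)
  have ac: "abs_cont_on 0 T p" using rep(1) T by (simp add: loc_abs_cont_def)
  define v where "v = vdot p"
  define w where "w = wdot p"
  obtain N1 where N1: "negligible N1"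
      "\<forall>t\<in>{0..T} - N1. ((\<lambda>s. fst (p s)) has_vector_derivative v t) (at t)"
    using vdot_has_derivative[OF rep(1), of T] T unfolding v_def by auto
  obtain N2 where N2: "negligible N2"
      "\<forall>t\<in>{0..T} - N2. ((\<lambda>s. snd (p s)) has_vector_derivative w t) (at t)"
    using wdot_has_derivative[OF rep(1), of T] T unfolding w_def by auto
  define N where "N = N1 \<union> N2 \<union> {0, T}"
  have N: "negligible N" using N1 N2 by (simp add: N_def)
  have W': "((\<lambda>s. snd (p s)) has_vector_derivative w t) (at t)" if "t \<in> {0..T} - N" for t
    using N2(2) that by (auto simp: N_def)
  \<comment> \<open>The sign comes from the monotonicity of the first component, since
    \<open>p\<close> is only known to be equivalent to a member of
    \<open>gen_control_params\<close>.\<close>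
  have v0: "v t \<ge> 0" if t: "t \<in> {0..T} - N" for t
  proof (rule mono_on_imp_deriv_nonneg)
    show "mono_on {0..T} (\<lambda>s. fst (p s))" using rep(3) by (auto intro!: mono_onI)
    show "((\<lambda>s. fst (p s)) has_real_derivative v t) (at t)"
      using N1(2) t by (auto simp: N_def has_real_derivative_iff_has_vector_derivative)
    show "t \<in> interior {0..T}" using t by (auto simp: N_def less_le)
  qed
  have T0: "0 \<le> T" using T by simp
  have vi: "v absolutely_integrable_on {0..T}"
    using abs_cont_on_fundamental_theorem(1)[OF abs_cont_on_fst[OF ac] T0 N1(1)] N1(2) by blast
  have "(v has_integral (fst (p T) - fst (p 0))) {0..T}"
    using abs_cont_on_fundamental_theorem(2)[OF abs_cont_on_fst[OF ac] T0 N1(1)] N1(2) T0 by blast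
  then have iv: "(v has_integral 1) {0..T}" using T rep(2) by simp
  have wi: "w absolutely_integrable_on {0..T}"
    using abs_cont_on_fundamental_theorem(1)[OF abs_cont_on_snd[OF ac] T0 N2(1)] N2(2) by blast
  have tr: "traj f g x0 (vdot p) (wdot p) t = y t" if "t \<in> {0..T}" for t
    by (rule traj_eq[OF lip driftless wi[unfolded w_def] y that])
  have yT: "y T = x1" using tr[of T] x1 T by simp
  \<comment> \<open>\<open>m\<close> is \<open>T\<close> plus the length of the curve traced by the
    second component, hence at least \<open>T\<close> and positive.\<close>
  define m where "m = integral {0..T} (\<lambda>s. 1 + norm (w s))"
  have nwi: "(\<lambda>s. norm (w s)) absolutely_integrable_on {0..T}" using wi by (rule set_integrable_norm)
  have n1: "(\<lambda>s. 1 + norm (w s)) absolutely_integrable_on {0..T}"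
    by (rule set_integral_add(1)[OF _ nwi]) (simp add: absolutely_integrable_on_const)
  have "integral {0..T} (\<lambda>s. 1 + norm (w s)) \<ge> integral {0..T} (\<lambda>s. 1)"
    by (rule integral_le) (use set_lebesgue_integral_eq_integral(1)[OF n1] in auto)
  then have m: "m > 0" using T by (simp add: m_def)
  define \<psi> where "\<psi> s = (1 + norm (w s)) / m" for s
  have \<psi>i: "\<psi> absolutely_integrable_on {0..T}"
    using set_integrable_mult_right[of "inverse m", OF n1]
    by (simp add: \<psi>_def[abs_def] divide_inverse mult.commute)
  have i\<psi>: "(\<psi> has_integral 1) {0..T}"
    using has_integral_divide[OF integrable_integral[OF set_lebesgue_integral_eq_integral(1)[OF n1]], of m] m
    by (simp add: \<psi>_def[abs_def] m_def)
  have \<psi>0: "\<psi> s > 0" for s unfolding \<psi>_def using m by (intro divide_pos_pos add_pos_nonneg) auto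
  have w\<psi>: "norm (w s /\<^sub>R \<psi> s) \<le> m" for s
  proof -
    have "norm (w s) \<le> m * \<psi> s" using m by (simp add: \<psi>_def)
    then have "norm (w s) / \<psi> s \<le> m" using \<psi>0[of s] by (simp add: pos_divide_le_eq)
    then show ?thesis using \<psi>0[of s] by (simp add: divide_inverse mult.commute)
  qed
  have conty: "continuous_on {0..T} y"
    using y abs_cont_on_imp_continuous_on unfolding solves_on_def by blast
  obtain M where M: "\<forall>t\<in>{0..T}. \<forall>z. norm z \<le> m \<longrightarrow> \<bar>L (y t) z\<bar> \<le> M"
    using lagrangian_bound[OF L_cont conty] by blast
  have Lc: "continuous_on UNIV (L z)" for z
    using continuous_on_compose2[OF L_cont, of UNIV "\<lambda>u. (z, u)"] by (simp add: continuous_on_Pair)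
  show ?thesis
  proof (intro exI[of _ M] allI impI)
    fix \<eta> :: real assume \<eta>: "0 < \<eta>" "\<eta> < 1"
    define \<omega> where "\<omega> s = (1 - \<eta>) * v s + \<eta> * \<psi> s" for s
    have \<omega>i: "\<omega> absolutely_integrable_on {0..T}"
      unfolding \<omega>_def[abs_def] by (intro set_integral_add(1) set_integrable_mult_right vi \<psi>i)
    have "(\<omega> has_integral ((1 - \<eta>) * 1 + \<eta> * 1)) {0..T}"
      unfolding \<omega>_def[abs_def] by (intro has_integral_add has_integral_mult_right iv i\<psi>)
    then have \<omega>1: "integral {0..T} \<omega> = 1" by (simp add: integral_unique)
    have \<omega>\<psi>: "\<eta> * \<psi> s \<le> \<omega> s" if "s \<in> {0..T} - N" for s
      using v0[OF that] \<eta> by (simp add: \<omega>_def)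
    have c: "\<eta> / m \<le> \<omega> s" if "s \<in> {0..T} - N" for s
    proof -
      have "\<eta> / m \<le> \<eta> * \<psi> s" using \<eta> m by (simp add: \<psi>_def divide_right_mono)
      then show ?thesis using \<omega>\<psi>[OF that] by linarith
    qed
    have B: "norm (w s) \<le> (m / \<eta>) * \<omega> s" if "s \<in> {0..T} - N" for s
    proof -
      have "norm (w s) \<le> (m / \<eta>) * (\<eta> * \<psi> s)" using \<eta> m by (simp add: \<psi>_def)
      also have "\<dots> \<le> (m / \<eta>) * \<omega> s" using \<omega>\<psi>[OF that] m \<eta> by (intro mult_left_mono) auto
      finally show ?thesis .
    qed
    have cp: "\<eta> / m > 0" using \<eta> m by simp
    let ?H = "\<lambda>s. L (y s) (w s /\<^sub>R \<omega> s) * \<omega> s"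
    obtain u where u: "set_integrable lebesgue {0..1} u" "traj_defined f g x0 (\<lambda>_. 1) u 1"
        "traj f g x0 (\<lambda>_. 1) u 1 = y T" "?H absolutely_integrable_on {0..T}"
        "gen_cost f g L x0 (graph_control u) = ereal (integral {0..T} ?H)"
      using ordinary_control_of_reparametrization[OF lip driftless L_cont T(1) abs_cont_on_snd[OF ac] _ N W'
          y[folded w_def] \<omega>i cp c \<omega>1 B] rep(2) by auto
    define I where "I = integral {0..T} ?H"
    \<comment> \<open>This is the convexity inequality solved for \<open>lam\<close>, with
      \<open>L\<close> at the quotient of \<open>w\<close> by \<psi> replaced by its bound
      \<open>M\<close>. As \<psi> has integral 1, integration gives exactly the bound
      claimed.\<close>
    let ?K = "\<lambda>s. (?H s - \<eta> * M * \<psi> s) / (1 - \<eta>)"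
    have K: "?K absolutely_integrable_on {0..T}"
      using set_integrable_mult_right[of "inverse (1 - \<eta>)", OF set_integral_diff(1)[OF u(4) set_integrable_mult_right[OF \<psi>i, of "\<eta> * M"]]]
      by (simp add: divide_inverse mult.commute)
    have "(?K has_integral ((I - \<eta> * M * 1) / (1 - \<eta>))) {0..T}"
      unfolding I_def
      by (intro has_integral_divide has_integral_diff has_integral_mult_right i\<psi>
          integrable_integral set_lebesgue_integral_eq_integral(1) u(4))
    then have iK: "integral {0..T} ?K = (I - \<eta> * M) / (1 - \<eta>)"
      unfolding mult_1_right by (rule integral_unique)
    have le: "ereal (?K s) \<le> lam L (y s) (v s) (w s)" if s: "s \<in> {0..T} - N" for s
    proof -
      have "L (y s) (w s /\<^sub>R \<psi> s) \<le> M" using M w\<psi>[of s] s by fastforce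
      then have "\<eta> * (L (y s) (w s /\<^sub>R \<psi> s) * \<psi> s) \<le> \<eta> * (M * \<psi> s)"
        using \<psi>0[of s] \<eta> by (intro mult_left_mono mult_right_mono) auto
      then have X: "\<eta> * (L (y s) (w s /\<^sub>R \<psi> s) * \<psi> s) \<le> \<eta> * M * \<psi> s" by (simp only: mult.assoc)
      have bound: "ereal (?H s) \<le> ereal (1 - \<eta>) * lam L (y s) (v s) (w s) +
          ereal (\<eta> * (L (y s) (w s /\<^sub>R \<psi> s) * \<psi> s))"
        unfolding \<omega>_def by (rule lam_perspective_bound[OF L_conv Lc v0[OF s] \<psi>0 \<eta>])
      show ?thesis
      \<comment> \<open>The value \<infinity> is trivial, and -\<infinity> contradicts
        \<open>bound\<close>, whose left side is real.\<close>
      proof (cases "lam L (y s) (v s) (w s)")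
        case (real r)
        then have "?H s \<le> (1 - \<eta>) * r + \<eta> * (L (y s) (w s /\<^sub>R \<psi> s) * \<psi> s)"
          using bound by simp
        then have "?H s - \<eta> * M * \<psi> s \<le> r * (1 - \<eta>)" using X by (simp add: mult.commute)
        then show ?thesis using \<eta> by (simp add: real pos_divide_le_eq)
      next
        case MInf
        then show ?thesis using bound \<eta> by simp
      qed simp
    qed
    have "ereal (integral {0..T} ?K) = ereal_integral {0..T} (\<lambda>s. ereal (?K s))"
      by (rule ereal_integral_real[OF K, symmetric])
    also have "\<dots> \<le> gen_cost f g L x0 p"
      unfolding gen_cost_def T_def[symmetric]
    proof (rule ereal_integral_mono)
      have "N \<in> null_sets lebesgue" using N by (simp add: negligible_iff_null_sets)
      from AE_not_in[OF this]
      show "AE t in lebesgue. t \<in> {0..T} \<longrightarrow>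
          ereal (?K t) \<le> lam L (traj f g x0 (vdot p) (wdot p) t) (vdot p t) (wdot p t)"
        by eventually_elim (use le tr in \<open>auto simp: v_def w_def\<close>)
    qed
    finally have "ereal ((I - \<eta> * M) / (1 - \<eta>)) \<le> gen_cost f g L x0 p" unfolding iK .
    then show "\<exists>u I. set_integrable lebesgue {0..1} u \<and>
     traj_defined f g x0 (\<lambda>_. 1) u 1 \<and> traj f g x0 (\<lambda>_. 1) u 1 = x1 \<and>
     gen_cost f g L x0 (graph_control u) = ereal I \<and>
     ereal ((I - \<eta> * M) / (1 - \<eta>)) \<le> gen_cost f g L x0 p"
      using u yT by (intro exI[of _ u] exI[of _ I]) (simp add: I_def)
  qed
qed

theorem proposition41:
  fixes f :: "real^'n \<Rightarrow> real^'n"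
    and g :: "'k::finite \<Rightarrow> real^'n \<Rightarrow> real^'n"
    and L :: "real^'n \<Rightarrow> real^'k \<Rightarrow> real"
    and x0 x1 :: "real^'n"
  assumes "local_lipschitz (UNIV :: real set) UNIV (\<lambda>_. f)"
    and "\<And>i. local_lipschitz (UNIV :: real set) UNIV (\<lambda>_. g i)"
    and "continuous_on UNIV (\<lambda>(x, u). L x u)"
    and "\<And>x. convex_on UNIV (L x)"
    and "\<And>x. f x = 0"
  shows "\<not> lavrentiev_gap f g L x0 x1"
proof -
  define F where "F = (\<lambda>\<epsilon>. INF u\<in>ordinary_controls f g x0 x1 \<epsilon>. gen_cost f g L x0 (graph_control u))"
  \<comment> \<open>A larger tolerance admits more controls, so the limit of \<open>F\<close> at 0
    is its supremum, and it suffices to bound each \<open>F \<epsilon>\<close>.\<close>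
  have "F t \<le> F s" if "s \<le> t" for s t
    unfolding F_def by (rule INF_superset_mono) (use that in \<open>auto simp: ordinary_controls_def\<close>)
  then have "(F \<longlongrightarrow> (SUP \<epsilon>\<in>{0<..}. F \<epsilon>)) (at_right 0)"
    by (intro antimono_tendsto_at_right)
  then have Lim: "Lim (at_right 0) F = (SUP \<epsilon>\<in>{0<..}. F \<epsilon>)"
    by (intro tendsto_Lim) auto
  have "F \<epsilon> \<le> gen_cost f g L x0 p" if \<epsilon>: "\<epsilon> > 0" and p: "p \<in> steering_gen_controls f g x0 x1" for \<epsilon> p
  proof -
    obtain M where M: "\<forall>\<eta>. 0 < \<eta> \<longrightarrow> \<eta> < 1 \<longrightarrow> (\<exists>u I. set_integrable lebesgue {0..1} u \<and>
       traj_defined f g x0 (\<lambda>_. 1) u 1 \<and> traj f g x0 (\<lambda>_. 1) u 1 = x1 \<and>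
       gen_cost f g L x0 (graph_control u) = ereal I \<and>
       ereal ((I - \<eta> * M) / (1 - \<eta>)) \<le> gen_cost f g L x0 p)"
      using gen_cost_approximation[OF assms(2,5,3,4) p] by blast
    have step: "\<exists>I. F \<epsilon> \<le> ereal I \<and> ereal ((I - \<eta> * M) / (1 - \<eta>)) \<le> gen_cost f g L x0 p"
      if \<eta>: "0 < \<eta>" "\<eta> < 1" for \<eta>
    proof -
      obtain u I where u: "set_integrable lebesgue {0..1} u"
       "traj_defined f g x0 (\<lambda>_. 1) u 1" "traj f g x0 (\<lambda>_. 1) u 1 = x1"
       "gen_cost f g L x0 (graph_control u) = ereal I"
       "ereal ((I - \<eta> * M) / (1 - \<eta>)) \<le> gen_cost f g L x0 p"
        using M[rule_format, OF \<eta>] by blast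
      \<comment> \<open>The endpoint is \<open>x1\<close> exactly, so the control is admissible for
        every positive \<epsilon>.\<close>
      have "u \<in> ordinary_controls f g x0 x1 \<epsilon>"
        using u \<epsilon> by (simp add: ordinary_controls_def)
      then have "F \<epsilon> \<le> gen_cost f g L x0 (graph_control u)"
        unfolding F_def by (rule INF_lower)
      then show ?thesis using u(4,5) by auto
    qed
    show ?thesis
    \<comment> \<open>For a real cost \<open>r\<close> the upper bound for
      \<open>F \<epsilon>\<close> tends to \<open>r\<close> as \<eta> tends to 0. The cost
      -\<infinity> is excluded by a single \<eta>, here 1/2, because a real number lies below the
      cost.\<close>
    proof (cases "gen_cost f g L x0 p")
      case (real r)
      have "F \<epsilon> \<le> ereal ((1 - \<eta>) * r + \<eta> * M)" if \<eta>: "0 < \<eta>" "\<eta> < 1" for \<eta>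
      proof -
        obtain I where I: "F \<epsilon> \<le> ereal I" "(I - \<eta> * M) / (1 - \<eta>) \<le> r"
          using step[OF \<eta>] real by auto
        have "I \<le> (1 - \<eta>) * r + \<eta> * M" using I(2) \<eta> by (simp add: pos_divide_le_eq mult.commute)
        then show ?thesis using I(1) by (meson ereal_less_eq(3) order_trans)
      qed
      then have ev: "\<forall>\<^sub>F \<eta> in at_right 0. F \<epsilon> \<le> ereal ((1 - \<eta>) * r + \<eta> * M)"
        unfolding eventually_at_right_field by (intro exI[of _ 1]) auto
      have "((\<lambda>\<eta>. ereal ((1 - \<eta>) * r + \<eta> * M)) \<longlongrightarrow> ereal ((1 - 0) * r + 0 * M)) (at_right 0)"
        by (intro tendsto_intros)
      from tendsto_lowerbound[OF this ev] show ?thesis by (simp add: real)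
    next
      case MInf
      then show ?thesis using step[of "1/2"] by auto
    qed simp
  qed
  then have "Lim (at_right 0) F \<le> (INF p\<in>steering_gen_controls f g x0 x1. gen_cost f g L x0 p)"
    unfolding Lim by (intro SUP_least INF_greatest) auto
  then show ?thesis unfolding lavrentiev_gap_def F_def by (simp add: not_less)
qed

end
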